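(* Let $h_1,h_2,h_3\in\mathbb R$ with $h_1^2\geq h_2^2\geq h_3^2$ and $P>0$. The sum-capacity $C_R$ of the restricted Gaussian Y-channel with gains $h_1,h_2,h_3$ and power $P$ satisfies $$C_R\leq 2C((h_2^2+h_3^2)P).$$
   Context: $C(x)=\frac12\log_2(1+x)$. The restricted (reciprocal) Gaussian Y-channel with real gains $h_1,h_2,h_3$ and power $P>0$: users $1,2,3$ and a relay $r$. For each ordered pair $(j,k)$ of distinct indices in $\{1,2,3\}$, user $j$ holds a message $m_{jk}$, uniform on $\{1,\dots,2^{nR_{jk}}\}$, intended for user $k$; the six messages are mutually independent. Over channel uses $i=1,\dots,n$, the relay receives $Y_{ri}=h_1X_{1i}+h_2X_{2i}+h_3X_{3i}+Z_{ri}$ and user $j$ receives $Y_{ji}=h_jX_{ri}+Z_{ji}$, all noise samples i.i.d. $\mathcal N(0,1)$ independent of the messages. Restricted encoding: $X_j^n=f_j(m_{jk},m_{jl})$ ($\{k,l\}=\{1,2,3\}\setminus\{j\}$); relay $X_{ri}=f_{ri}(Y_r^{i-1})$; power constraints $\frac1n\sum_i\mathbb E[X_{ai}^2]\le P$ for $a\in\{1,2,3,r\}$; user $j$ estimates $(m_{kj},m_{lj})$ from $(Y_j^n,m_{jk},m_{jl})$. A rate tuple is achievable if codes exist whose error probability tends to $0$ as $n\to\infty$; $C_R$ is the supremum of $\sum_{j\ne k}R_{jk}$ over achievable tuples. *)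

theory Defs
  imports "HOL-Probability.Probability"
begin

text \<open>Restricted Gaussian Y-channel. Users are indexed 1,2,3; in the noise
index, channel 0 is the relay and channel j (j = 1,2,3) is user j.
Time indices are 0-based: i < n.\<close>

definition C :: "real \<Rightarrow> real" where
  "C x = 1/2 * log 2 (1 + x)"

definition pairs :: "(nat \<times> nat) set" where
  "pairs = {(j,k). j \<in> {1,2,3} \<and> k \<in> {1,2,3} \<and> j \<noteq> k}"

definition msg_size :: "nat \<Rightarrow> real \<Rightarrow> nat" where
  "msg_size n r = nat \<lceil>2 powr (real n * r)\<rceil>"

definition msg_set :: "nat \<Rightarrow> (nat \<times> nat \<Rightarrow> real) \<Rightarrow> (nat \<times> nat \<Rightarrow> nat) set" where
  "msg_set n R = PiE pairs (\<lambda>jk. {..<msg_size n (R jk)})"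

text \<open>i.i.d. N(0,1) noise samples: omega (a,i), a = 0 relay, a = 1,2,3 users.\<close>
definition noise_space :: "nat \<Rightarrow> (nat \<times> nat \<Rightarrow> real) measure" where
  "noise_space n = PiM ({..3} \<times> {..<n}) (\<lambda>_. density lborel std_normal_density)"

text \<open>Encoder: enc j u i is the i-th symbol of user j given its own messages
u k = m_jk (restricted encoding: depends only on user j's messages).\<close>
definition user_sig :: "(nat \<Rightarrow> (nat \<Rightarrow> nat) \<Rightarrow> nat \<Rightarrow> real) \<Rightarrow> nat \<Rightarrow> (nat \<times> nat \<Rightarrow> nat) \<Rightarrow> nat \<Rightarrow> real" where
  "user_sig enc j m i = enc j (\<lambda>k. m (j,k)) i"

definition relay_rx :: "(nat \<Rightarrow> real) \<Rightarrow> (nat \<Rightarrow> (nat \<Rightarrow> nat) \<Rightarrow> nat \<Rightarrow> real)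
    \<Rightarrow> (nat \<times> nat \<Rightarrow> nat) \<Rightarrow> (nat \<times> nat \<Rightarrow> real) \<Rightarrow> nat \<Rightarrow> real" where
  "relay_rx h enc m \<omega> i = h 1 * user_sig enc 1 m i + h 2 * user_sig enc 2 m i
                          + h 3 * user_sig enc 3 m i + \<omega> (0,i)"

definition relay_sig :: "(nat \<Rightarrow> real) \<Rightarrow> (nat \<Rightarrow> (nat \<Rightarrow> nat) \<Rightarrow> nat \<Rightarrow> real)
    \<Rightarrow> (nat \<Rightarrow> (nat \<Rightarrow> real) \<Rightarrow> real)
    \<Rightarrow> (nat \<times> nat \<Rightarrow> nat) \<Rightarrow> (nat \<times> nat \<Rightarrow> real) \<Rightarrow> nat \<Rightarrow> real" where
  "relay_sig h enc rel m \<omega> i = rel i (restrict (relay_rx h enc m \<omega>) {..<i})"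

definition user_rx :: "(nat \<Rightarrow> real) \<Rightarrow> (nat \<Rightarrow> (nat \<Rightarrow> nat) \<Rightarrow> nat \<Rightarrow> real)
    \<Rightarrow> (nat \<Rightarrow> (nat \<Rightarrow> real) \<Rightarrow> real) \<Rightarrow> nat
    \<Rightarrow> (nat \<times> nat \<Rightarrow> nat) \<Rightarrow> (nat \<times> nat \<Rightarrow> real) \<Rightarrow> nat \<Rightarrow> real" where
  "user_rx h enc rel j m \<omega> i = h j * relay_sig h enc rel m \<omega> i + \<omega> (j,i)"

text \<open>Decoder: dec j u y k is user j's estimate of m_kj from its own messages
u (u k = m_jk) and its received block y = Y_j^n.\<close>
definition dec_error :: "nat \<Rightarrow> (nat \<Rightarrow> real) \<Rightarrow> (nat \<Rightarrow> (nat \<Rightarrow> nat) \<Rightarrow> nat \<Rightarrow> real)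
    \<Rightarrow> (nat \<Rightarrow> (nat \<Rightarrow> real) \<Rightarrow> real) \<Rightarrow> (nat \<Rightarrow> (nat \<Rightarrow> nat) \<Rightarrow> (nat \<Rightarrow> real) \<Rightarrow> nat \<Rightarrow> nat)
    \<Rightarrow> (nat \<times> nat \<Rightarrow> nat) \<Rightarrow> (nat \<times> nat \<Rightarrow> real) \<Rightarrow> bool" where
  "dec_error n h enc rel dec m \<omega> =
     (\<exists>(k,j)\<in>pairs. dec j (\<lambda>k'. m (j,k')) (restrict (user_rx h enc rel j m \<omega>) {..<n}) k \<noteq> m (k,j))"

definition error_prob where
  "error_prob n R h enc rel dec =
     (\<Sum>m\<in>msg_set n R. measure (noise_space n)
         {\<omega> \<in> space (noise_space n). dec_error n h enc rel dec m \<omega>}) / real (card (msg_set n R))"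

definition valid_code where
  "valid_code n R h P enc rel dec \<longleftrightarrow>
     (\<forall>i<n. rel i \<in> borel_measurable (PiM {..<i} (\<lambda>_. borel)))
   \<and> (\<forall>m\<in>msg_set n R. \<forall>j\<in>{1,2,3}. \<forall>k.
        (\<lambda>y. dec j (\<lambda>k'. m (j,k')) y k) \<in> measurable (PiM {..<n} (\<lambda>_. borel)) (count_space UNIV))
   \<and> (\<forall>j\<in>{1,2,3}. (\<Sum>i<n. \<Sum>m\<in>msg_set n R. (user_sig enc j m i)\<^sup>2)
                     \<le> real n * real (card (msg_set n R)) * P)
   \<and> (\<Sum>i<n. \<Sum>m\<in>msg_set n R. \<integral>\<^sup>+ \<omega>. ennreal ((relay_sig h enc rel m \<omega> i)\<^sup>2) \<partial>noise_space n)
        \<le> ennreal (real n * real (card (msg_set n R)) * P)"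

definition achievable :: "(nat \<Rightarrow> real) \<Rightarrow> real \<Rightarrow> (nat \<times> nat \<Rightarrow> real) \<Rightarrow> bool" where
  "achievable h P R \<longleftrightarrow> (\<forall>jk\<in>pairs. R jk \<ge> 0) \<and>
     (\<exists>enc rel dec. (\<forall>n>0. valid_code n R h P (enc n) (rel n) (dec n)) \<and>
        (\<lambda>n. error_prob n R h (enc n) (rel n) (dec n)) \<longlonglongrightarrow> 0)"

definition sum_capacity :: "(nat \<Rightarrow> real) \<Rightarrow> real \<Rightarrow> ereal" where
  "sum_capacity h P = (SUP R \<in> {R. achievable h P R}. ereal (\<Sum>jk\<in>pairs. R jk))"

end

theory Submission
  imports Defs
begin

text \<open>
The six rates split into two triples, each bounded by the capacity at the signal-to-noise ratio
S = (h_2^2 + h_3^2) P.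

Uplink: a receiver that sees the relay's input and knows m_12, m_13, m_32 decodes m_21, m_31 as
user 1, and then, knowing m_31 and m_32, decodes m_23 as user 3. Users 2 and 3 send independent
signals, so after centring one of them the power arriving at the relay is at most S.

Downlink: a receiver that sees the outputs of users 2 and 3 and knows m_21, m_23, m_31 decodes
m_12, m_32 as user 2, and then m_13 as user 3. Given the relay noise this is one input observed
through the two gains h_2, h_3.

Both bounds come from the same change of measure. Let T be the log-likelihood ratio between the
true output and a fixed Gaussian output law Q, and let A be the event of correct decoding of one
of M messages. Under Q the event A has probability at most 1/M, so exp(-T) (1 + (M - 1) 1_A) has
expectation at most 2, and ln r \<le> r - 1 gives P(A) ln M \<le> E T + ln 2. For Q with the
variance of the power constraint, E T is at most n/2 ln(1 + S). This replaces Fano's inequality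
and the maximum entropy property of Gaussian laws.
\<close>

section \<open>Translations of Gaussian product measures\<close>

abbreviation gauss :: "real measure" where
  "gauss \<equiv> density lborel std_normal_density"

interpretation gauss: prob_space gauss
  using prob_space_normal_density[of 1 0] by simp

interpretation gauss_PiM: product_sigma_finite "\<lambda>_::'i. gauss"
  by unfold_locales

text \<open>One-dimensional Cameron-Martin formula. The weight is the ratio of the normal densities
  at \<open>z + a\<close> and at \<open>z\<close>, so only the translation invariance of Lebesgue
  measure remains.\<close>

lemma nn_integral_gauss_shift:
  fixes a :: real
  assumes [measurable]: "F \<in> borel_measurable borel"
  shows "(\<integral>\<^sup>+z. F (z + a) * ennreal (exp (- (a * z + a\<^sup>2 / 2))) \<partial>gauss) = (\<integral>\<^sup>+z. F z \<partial>gauss)"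
proof -
  have *: "std_normal_density z * exp (- (a * z + a\<^sup>2 / 2)) = std_normal_density (z + a)" for z
    by (simp add: normal_density_def exp_add[symmetric] exp_minus[symmetric] mult_exp_exp
        power2_eq_square algebra_simps add_divide_distrib)
  have "(\<integral>\<^sup>+z. F (z + a) * ennreal (exp (- (a * z + a\<^sup>2 / 2))) \<partial>gauss)
     = (\<integral>\<^sup>+z. ennreal (std_normal_density z) * (F (z + a) * ennreal (exp (- (a * z + a\<^sup>2 / 2)))) \<partial>lborel)"
    by (rule nn_integral_density) measurable
  also have "\<dots> = (\<integral>\<^sup>+z. ennreal (std_normal_density (a + 1 * z)) * F (a + 1 * z) \<partial>lborel)"
  proof (rule nn_integral_cong)
    fix z :: real
    have "ennreal (std_normal_density z) * (F (z + a) * ennreal (exp (- (a * z + a\<^sup>2 / 2))))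
        = ennreal (std_normal_density z * exp (- (a * z + a\<^sup>2 / 2))) * F (z + a)"
      by (subst ennreal_mult) (auto simp: mult_ac)
    then show "ennreal (std_normal_density z) * (F (z + a) * ennreal (exp (- (a * z + a\<^sup>2 / 2))))
        = ennreal (std_normal_density (a + 1 * z)) * F (a + 1 * z)"
      unfolding * by (simp add: add.commute)
  qed
  also have "\<dots> = (\<integral>\<^sup>+z. ennreal (std_normal_density z) * F z \<partial>lborel)"
    by (subst nn_integral_real_affine[where c=1 and t=a]) auto
  also have "\<dots> = (\<integral>\<^sup>+z. F z \<partial>gauss)"
    by (rule nn_integral_density[symmetric]) measurable
  finally show ?thesis .
qed

text \<open>The weight factors over coordinates. Fubini splits off one coordinate at a time: the
  induction hypothesis removes the shift from the inner integral and the one-dimensional formula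
  removes it from the outer one.\<close>

lemma nn_integral_gauss_PiM_shift:
  fixes a :: "'i \<Rightarrow> real"
  assumes "finite J" and "F \<in> borel_measurable (PiM J (\<lambda>_. gauss))"
  shows "(\<integral>\<^sup>+z. F (\<lambda>j\<in>J. z j + a j) * ennreal (exp (- (\<Sum>j\<in>J. a j * z j + (a j)\<^sup>2 / 2))) \<partial>PiM J (\<lambda>_. gauss))
     = (\<integral>\<^sup>+z. F z \<partial>PiM J (\<lambda>_. gauss))"
  using assms
proof (induction J arbitrary: F rule: finite_induct)
  case empty
  then show ?case by (simp add: PiM_empty nn_integral_count_space_finite)
next
  case (insert i J)
  note [measurable] = insert.prems
  let ?E = "\<lambda>J z. ennreal (exp (- (\<Sum>j\<in>J. a j * z j + (a j)\<^sup>2 / 2)))"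
  let ?e = "\<lambda>y. ennreal (exp (- (a i * y + (a i)\<^sup>2 / 2)))"
  have sh[measurable]: "(\<lambda>z. \<lambda>j\<in>insert i J. z j + a j) \<in> measurable (PiM (insert i J) (\<lambda>_. gauss)) (PiM (insert i J) (\<lambda>_. gauss))"
    by (rule measurable_restrict) measurable
  have upd[measurable]: "(\<lambda>x. x(i := y)) \<in> measurable (PiM J (\<lambda>_. gauss)) (PiM (insert i J) (\<lambda>_. gauss))" for y
    by (rule measurable_fun_upd[where J=J]) auto
  have upd2[measurable]: "(\<lambda>(y, x). x(i := y)) \<in> measurable (borel \<Otimes>\<^sub>M PiM J (\<lambda>_. gauss)) (PiM (insert i J) (\<lambda>_. gauss))"
    unfolding split_beta by (rule measurable_fun_upd[where J=J]) auto
  have "(\<integral>\<^sup>+z. F (\<lambda>j\<in>insert i J. z j + a j) * ?E (insert i J) z \<partial>PiM (insert i J) (\<lambda>_. gauss))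
     = (\<integral>\<^sup>+y. (\<integral>\<^sup>+x. F (\<lambda>j\<in>insert i J. (x(i:=y)) j + a j) * ?E (insert i J) (x(i:=y)) \<partial>PiM J (\<lambda>_. gauss)) \<partial>gauss)"
    using insert.hyps by (intro gauss_PiM.product_nn_integral_insert_rev) measurable
  also have "\<dots> = (\<integral>\<^sup>+y. (\<integral>\<^sup>+x. (F ((\<lambda>j\<in>J. x j + a j)(i := y + a i)) * ?E J x) * ?e y \<partial>PiM J (\<lambda>_. gauss)) \<partial>gauss)"
  proof (intro nn_integral_cong)
    fix y x
    have 1: "(\<lambda>j\<in>insert i J. (x(i:=y)) j + a j) = (\<lambda>j\<in>J. x j + a j)(i := y + a i)"
      using insert.hyps by (auto simp: fun_eq_iff)
    have 2: "(\<Sum>j\<in>J. a j * (x(i := y)) j + (a j)\<^sup>2 / 2) = (\<Sum>j\<in>J. a j * x j + (a j)\<^sup>2 / 2)"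
      using insert.hyps by (intro sum.cong) auto
    have 3: "?E (insert i J) (x(i:=y)) = ?E J x * ?e y"
      unfolding ennreal_mult'[symmetric, OF exp_ge_zero] mult_exp_exp
      using insert.hyps 2 by (simp add: algebra_simps)
    show "F (\<lambda>j\<in>insert i J. (x(i:=y)) j + a j) * ?E (insert i J) (x(i:=y))
       = (F ((\<lambda>j\<in>J. x j + a j)(i := y + a i)) * ?E J x) * ?e y"
      unfolding 1 3 by (simp add: mult_ac)
  qed
  also have "\<dots> = (\<integral>\<^sup>+y. (\<integral>\<^sup>+x. F ((\<lambda>j\<in>J. x j + a j)(i := y + a i)) * ?E J x \<partial>PiM J (\<lambda>_. gauss)) * ?e y \<partial>gauss)"
  proof (intro nn_integral_cong nn_integral_multc)
    fix y :: real
    have [measurable]: "(\<lambda>x. (\<lambda>j\<in>J. x j + a j)) \<in> measurable (PiM J (\<lambda>_. gauss)) (PiM J (\<lambda>_. gauss))"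
      by (rule measurable_restrict) measurable
    show "(\<lambda>x. F ((\<lambda>j\<in>J. x j + a j)(i := y + a i)) * ?E J x) \<in> borel_measurable (PiM J (\<lambda>_. gauss))"
      by measurable
  qed
  also have "\<dots> = (\<integral>\<^sup>+y. (\<integral>\<^sup>+x. F (x(i := y + a i)) \<partial>PiM J (\<lambda>_. gauss)) * ?e y \<partial>gauss)"
    by (intro nn_integral_cong arg_cong2[where f="(*)"] insert.IH refl) measurable
  also have "\<dots> = (\<integral>\<^sup>+y. (\<integral>\<^sup>+x. F (x(i := y)) \<partial>PiM J (\<lambda>_. gauss)) \<partial>gauss)"
  proof (rule nn_integral_gauss_shift)
    interpret sigma_finite_measure "PiM J (\<lambda>_. gauss)"
      by (rule gauss_PiM.sigma_finite) fact
    show "(\<lambda>y. \<integral>\<^sup>+x. F (x(i := y)) \<partial>PiM J (\<lambda>_. gauss)) \<in> borel_measurable borel"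
      by (rule borel_measurable_nn_integral) measurable
  qed
  also have "\<dots> = (\<integral>\<^sup>+z. F z \<partial>PiM (insert i J) (\<lambda>_. gauss))"
    using insert.hyps by (intro gauss_PiM.product_nn_integral_insert_rev[symmetric]) measurable
  finally show ?case .
qed

text \<open>Once the coordinates outside \<open>J\<close> are frozen by Fubini, the shift is
  constant and the deterministic case applies. This form is needed because the relay's signal is
  random: it depends on the relay noise, but not on the noise at the users.\<close>

lemma nn_integral_gauss_PiM_adapted_shift:
  fixes a :: "('i \<Rightarrow> real) \<Rightarrow> 'i \<Rightarrow> real"
  assumes I: "finite I" and J: "J \<subseteq> I"
    and a[measurable]: "\<And>j. j \<in> J \<Longrightarrow> (\<lambda>\<omega>. a \<omega> j) \<in> borel_measurable (PiM I (\<lambda>_. gauss))"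
    and dep: "\<And>\<omega> \<omega>' j. j \<in> J \<Longrightarrow> (\<forall>k\<in>I - J. \<omega> k = \<omega>' k) \<Longrightarrow> a \<omega> j = a \<omega>' j"
    and F[measurable]: "F \<in> borel_measurable (PiM I (\<lambda>_. gauss))"
  shows "(\<integral>\<^sup>+\<omega>. F (\<lambda>k\<in>I. if k \<in> J then \<omega> k + a \<omega> k else \<omega> k)
            * ennreal (exp (- (\<Sum>j\<in>J. a \<omega> j * \<omega> j + (a \<omega> j)\<^sup>2 / 2))) \<partial>PiM I (\<lambda>_. gauss))
     = (\<integral>\<^sup>+\<omega>. F \<omega> \<partial>PiM I (\<lambda>_. gauss))"
proof -
  define K where "K = I - J"
  have KJ: "K \<inter> J = {}" "finite K" "finite J" and IK: "I = K \<union> J"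
    using I J finite_subset by (auto simp: K_def)
  have [measurable]: "(\<lambda>\<omega>. \<lambda>k\<in>I. if k \<in> J then \<omega> k + a \<omega> k else \<omega> k)
      \<in> measurable (PiM I (\<lambda>_. gauss)) (PiM I (\<lambda>_. gauss))"
  proof (rule measurable_restrict)
    fix k assume "k \<in> I"
    then show "(\<lambda>\<omega>. if k \<in> J then \<omega> k + a \<omega> k else \<omega> k) \<in> measurable (PiM I (\<lambda>_. gauss)) gauss"
      by (cases "k \<in> J") auto
  qed
  have "(\<integral>\<^sup>+\<omega>. F (\<lambda>k\<in>I. if k \<in> J then \<omega> k + a \<omega> k else \<omega> k)
            * ennreal (exp (- (\<Sum>j\<in>J. a \<omega> j * \<omega> j + (a \<omega> j)\<^sup>2 / 2))) \<partial>PiM I (\<lambda>_. gauss))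
    = (\<integral>\<^sup>+x. (\<integral>\<^sup>+y. F (\<lambda>k\<in>I. if k \<in> J then merge K J (x, y) k + a (merge K J (x, y)) k else merge K J (x, y) k)
            * ennreal (exp (- (\<Sum>j\<in>J. a (merge K J (x, y)) j * merge K J (x, y) j + (a (merge K J (x, y)) j)\<^sup>2 / 2)))
          \<partial>PiM J (\<lambda>_. gauss)) \<partial>PiM K (\<lambda>_. gauss))"
    unfolding IK using J by (intro gauss_PiM.product_nn_integral_fold KJ) (unfold IK[symmetric], measurable, auto)
  also have "\<dots> = (\<integral>\<^sup>+x. (\<integral>\<^sup>+y. F (merge K J (x, y)) \<partial>PiM J (\<lambda>_. gauss)) \<partial>PiM K (\<lambda>_. gauss))"
  proof (rule nn_integral_cong)
    fix x assume x: "x \<in> space (PiM K (\<lambda>_. gauss))"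
    \<comment> \<open>By \<open>dep\<close> the shift ignores the coordinates in \<open>J\<close>,
      so \<open>undefined\<close> is an arbitrary filler there.\<close>
    define b where "b = a (merge K J (x, undefined))"
    have ab: "a (merge K J (x, y)) j = b j" if "j \<in> J" for y j
      unfolding b_def using KJ that by (intro dep) (auto simp: K_def[symmetric] merge_def)
    have m[measurable]: "(\<lambda>y. merge K J (x, y)) \<in> measurable (PiM J (\<lambda>_. gauss)) (PiM I (\<lambda>_. gauss))"
      unfolding IK using x by (intro measurable_compose[OF _ measurable_merge]) simp
    have "(\<integral>\<^sup>+y. F (\<lambda>k\<in>I. if k \<in> J then merge K J (x, y) k + a (merge K J (x, y)) k else merge K J (x, y) k)
            * ennreal (exp (- (\<Sum>j\<in>J. a (merge K J (x, y)) j * merge K J (x, y) j + (a (merge K J (x, y)) j)\<^sup>2 / 2)))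
          \<partial>PiM J (\<lambda>_. gauss))
       = (\<integral>\<^sup>+y. F (merge K J (x, \<lambda>j\<in>J. y j + b j))
            * ennreal (exp (- (\<Sum>j\<in>J. b j * y j + (b j)\<^sup>2 / 2))) \<partial>PiM J (\<lambda>_. gauss))"
    proof (intro nn_integral_cong arg_cong2[where f="(*)"] arg_cong[where f=F] arg_cong[where f="\<lambda>t. ennreal (exp (- t))"])
      fix y
      show "(\<lambda>k\<in>I. if k \<in> J then merge K J (x, y) k + a (merge K J (x, y)) k else merge K J (x, y) k)
         = merge K J (x, \<lambda>j\<in>J. y j + b j)"
        using KJ by (auto simp: fun_eq_iff ab IK)
      show "(\<Sum>j\<in>J. a (merge K J (x, y)) j * merge K J (x, y) j + (a (merge K J (x, y)) j)\<^sup>2 / 2)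
         = (\<Sum>j\<in>J. b j * y j + (b j)\<^sup>2 / 2)"
        using KJ by (intro sum.cong refl) (simp add: ab)
    qed
    also have "\<dots> = (\<integral>\<^sup>+y. F (merge K J (x, y)) \<partial>PiM J (\<lambda>_. gauss))"
      by (rule nn_integral_gauss_PiM_shift[where F="\<lambda>y. F (merge K J (x, y))"]) (use KJ in measurable)
    finally show "(\<integral>\<^sup>+y. F (\<lambda>k\<in>I. if k \<in> J then merge K J (x, y) k + a (merge K J (x, y)) k else merge K J (x, y) k)
            * ennreal (exp (- (\<Sum>j\<in>J. a (merge K J (x, y)) j * merge K J (x, y) j + (a (merge K J (x, y)) j)\<^sup>2 / 2)))
          \<partial>PiM J (\<lambda>_. gauss)) = (\<integral>\<^sup>+y. F (merge K J (x, y)) \<partial>PiM J (\<lambda>_. gauss))" .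
  qed
  also have "\<dots> = (\<integral>\<^sup>+\<omega>. F \<omega> \<partial>PiM I (\<lambda>_. gauss))"
    unfolding IK by (intro gauss_PiM.product_nn_integral_fold[symmetric] KJ) (unfold IK[symmetric], rule F)
  finally show ?thesis .
qed

section \<open>Moments and orthogonality of the noise samples\<close>

lemma prob_space_gauss_PiM: "prob_space (PiM I (\<lambda>_::'i. gauss))"
  by (intro prob_space_PiM gauss.prob_space_axioms)

lemma gauss_moments:
  shows integral_gauss_id: "(\<integral>z. z \<partial>gauss) = 0"
    and integrable_gauss_square: "integrable gauss (\<lambda>z. z\<^sup>2)"
    and integral_gauss_square: "(\<integral>z. z\<^sup>2 \<partial>gauss) = 1"
  using std_normal_moment_odd[of 0] std_normal_moment_even[of 1]
  by (auto simp: integrable_density integral_density has_bochner_integral_iff fact_numeral)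

lemma gauss_PiM_component:
  assumes "i \<in> I" and f: "f \<in> borel_measurable borel"
  shows integrable_gauss_PiM_component:
      "integrable (PiM I (\<lambda>_::'i. gauss)) (\<lambda>\<omega>. f (\<omega> i) :: real) \<longleftrightarrow> integrable gauss f"
    and integral_gauss_PiM_component:
      "(\<integral>\<omega>. f (\<omega> i) \<partial>PiM I (\<lambda>_::'i. gauss)) = (\<integral>z. f z \<partial>gauss)"
proof -
  have d: "distr (PiM I (\<lambda>_::'i. gauss)) gauss (\<lambda>\<omega>. \<omega> i) = gauss"
    using distr_PiM_component[of I "\<lambda>_. gauss" i] assms(1) gauss.prob_space_axioms by simp
  have f': "f \<in> borel_measurable gauss" using f by simp
  have m: "(\<lambda>\<omega>. \<omega> i) \<in> measurable (PiM I (\<lambda>_::'i. gauss)) gauss"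
    using assms(1) by measurable
  show "integrable (PiM I (\<lambda>_::'i. gauss)) (\<lambda>\<omega>. f (\<omega> i) :: real) \<longleftrightarrow> integrable gauss f"
    using integrable_distr_eq[OF m f'] unfolding d by simp
  show "(\<integral>\<omega>. f (\<omega> i) \<partial>PiM I (\<lambda>_::'i. gauss)) = (\<integral>z. f z \<partial>gauss)"
    using integral_distr[OF m f'] unfolding d by simp
qed

lemma integrable_mult_of_squares:
  fixes f g :: "'a \<Rightarrow> real"
  assumes [measurable]: "f \<in> borel_measurable M" "g \<in> borel_measurable M"
    and "integrable M (\<lambda>x. (f x)\<^sup>2)" "integrable M (\<lambda>x. (g x)\<^sup>2)"
  shows "integrable M (\<lambda>x. f x * g x)"
proof (rule Bochner_Integration.integrable_bound)
  show "integrable M (\<lambda>x. (f x)\<^sup>2 + (g x)\<^sup>2)" using assms by auto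
  show "AE x in M. norm (f x * g x) \<le> norm ((f x)\<^sup>2 + (g x)\<^sup>2)"
  proof (intro AE_I2)
    fix x
    have "0 \<le> (\<bar>f x\<bar> - \<bar>g x\<bar>)\<^sup>2" by simp
    then have "2 * (\<bar>f x\<bar> * \<bar>g x\<bar>) \<le> (f x)\<^sup>2 + (g x)\<^sup>2" by (simp add: power2_diff)
    then have "\<bar>f x\<bar> * \<bar>g x\<bar> \<le> (f x)\<^sup>2 + (g x)\<^sup>2"
      using mult_nonneg_nonneg[OF abs_ge_zero abs_ge_zero, of "f x" "g x"] by linarith
    then show "norm (f x * g x) \<le> norm ((f x)\<^sup>2 + (g x)\<^sup>2)"
      by (simp add: abs_mult)
  qed
qed measurable

text \<open>Coordinate \<open>j\<close> is integrated first: \<open>x\<close> is constant along it,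
  and a standard normal variable has mean zero.\<close>

lemma integral_gauss_PiM_orthogonal:
  fixes x :: "('i \<Rightarrow> real) \<Rightarrow> real"
  assumes I: "finite I" "j \<in> I"
    and [measurable]: "x \<in> borel_measurable (PiM I (\<lambda>_. gauss))"
    and sq: "integrable (PiM I (\<lambda>_. gauss)) (\<lambda>\<omega>. (x \<omega>)\<^sup>2)"
    and dep: "\<And>\<omega> t. x ((fun_upd \<omega> j t)) = x \<omega>"
  shows "integrable (PiM I (\<lambda>_. gauss)) (\<lambda>\<omega>. x \<omega> * \<omega> j)"
    and "(\<integral>\<omega>. x \<omega> * \<omega> j \<partial>PiM I (\<lambda>_. gauss)) = 0"
proof -
  show int: "integrable (PiM I (\<lambda>_. gauss)) (\<lambda>\<omega>. x \<omega> * \<omega> j)"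
    using I sq integrable_gauss_PiM_component[of j I "\<lambda>z. z\<^sup>2"] integrable_gauss_square
    by (intro integrable_mult_of_squares) auto
  have ins: "insert j (I - {j}) = I" using I by auto
  have "(\<integral>\<omega>. x \<omega> * \<omega> j \<partial>PiM I (\<lambda>_. gauss))
     = (\<integral>\<omega>. (\<integral>t. x ((fun_upd \<omega> j t)) * ((fun_upd \<omega> j t)) j \<partial>gauss) \<partial>PiM (I - {j}) (\<lambda>_. gauss))"
    using gauss_PiM.product_integral_insert[of "I - {j}" j "\<lambda>\<omega>. x \<omega> * \<omega> j"] I int
    unfolding ins by simp
  also have "\<dots> = 0"
    by (simp add: dep integral_gauss_id)
  finally show "(\<integral>\<omega>. x \<omega> * \<omega> j \<partial>PiM I (\<lambda>_. gauss)) = 0" .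
qed

section \<open>Averaging likelihood ratios over a Gaussian input\<close>

lemma nn_integral_gauss_exp_quadratic:
  fixes a s :: real
  assumes "s \<ge> 0"
  shows "(\<integral>\<^sup>+t. ennreal (exp (t * a - t\<^sup>2 * s / 2)) \<partial>gauss)
     = ennreal (exp (a\<^sup>2 / (2 * (1 + s))) / sqrt (1 + s))"
proof -
  let ?\<sigma> = "1 / sqrt (1 + s)"
  have s: "0 < 1 + s" "sqrt (1 + s) > 0" using assms by auto
  \<comment> \<open>Completing the square in \<open>t\<close> leaves a multiple of the normal
    density with mean \<open>a / (1 + s)\<close> and variance \<open>1 / (1 + s)\<close>.\<close>
  have *: "std_normal_density t * exp (t * a - t\<^sup>2 * s / 2)
      = exp (a\<^sup>2 / (2 * (1 + s))) / sqrt (1 + s) * normal_density (a / (1 + s)) ?\<sigma> t" for t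
  proof -
    have "- t\<^sup>2 / 2 + (t * a - t\<^sup>2 * s / 2) = a\<^sup>2 / (2 * (1 + s)) - (t - a / (1 + s))\<^sup>2 * (1 + s) / 2"
    proof -
      define r where "r = 1 + s"
      have "(t - a / r)\<^sup>2 * r = t\<^sup>2 * r - 2 * t * a + a\<^sup>2 / r"
        using s by (simp add: r_def[symmetric] power2_eq_square field_simps)
      moreover have "a\<^sup>2 / (2 * r) = a\<^sup>2 / r / 2" by simp
      moreover have "t\<^sup>2 * s = t\<^sup>2 * r - t\<^sup>2" by (simp add: r_def algebra_simps)
      ultimately show ?thesis unfolding r_def[symmetric] by linarith
    qed
    moreover have "(t - a / (1 + s))\<^sup>2 / (2 * ?\<sigma>\<^sup>2) = (t - a / (1 + s))\<^sup>2 * (1 + s) / 2"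
      using s by (simp add: power_divide)
    ultimately have e: "exp (- t\<^sup>2 / 2) * exp (t * a - t\<^sup>2 * s / 2)
        = exp (a\<^sup>2 / (2 * (1 + s))) * exp (- (t - a / (1 + s))\<^sup>2 / (2 * ?\<sigma>\<^sup>2))"
      by (simp add: mult_exp_exp)
    have "sqrt (2 * pi * ?\<sigma>\<^sup>2) = sqrt (2 * pi) / sqrt (1 + s)"
      using s by (simp add: real_sqrt_mult real_sqrt_divide)
    then show ?thesis
      unfolding normal_density_def using e s by (simp add: field_simps)
  qed
  interpret N: prob_space "density lborel (normal_density (a / (1 + s)) ?\<sigma>)"
    using s by (intro prob_space_normal_density) auto
  have N1: "(\<integral>\<^sup>+t. ennreal (normal_density (a / (1 + s)) ?\<sigma> t) \<partial>lborel) = 1"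
    using N.emeasure_space_1 by (simp add: emeasure_density)
  have "(\<integral>\<^sup>+t. ennreal (exp (t * a - t\<^sup>2 * s / 2)) \<partial>gauss)
     = (\<integral>\<^sup>+t. ennreal (std_normal_density t) * ennreal (exp (t * a - t\<^sup>2 * s / 2)) \<partial>lborel)"
    by (rule nn_integral_density) measurable
  also have "\<dots> = (\<integral>\<^sup>+t. ennreal (exp (a\<^sup>2 / (2 * (1 + s))) / sqrt (1 + s)) * ennreal (normal_density (a / (1 + s)) ?\<sigma> t) \<partial>lborel)"
    using s by (intro nn_integral_cong) (simp add: ennreal_mult[symmetric] *)
  also have "\<dots> = ennreal (exp (a\<^sup>2 / (2 * (1 + s))) / sqrt (1 + s))"
    by (subst nn_integral_cmult) (simp_all add: N1)
  finally show ?thesis .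
qed

text \<open>The integrand is the density, with respect to the noise, of the output law of a
Gaussian input of power P sent over the fixed directions v.\<close>
lemma nn_integral_gauss_output_density:
  fixes I :: "('b \<times> nat) set" and v :: "'b \<Rightarrow> real" and P :: real
  assumes I: "finite I" and B: "finite B" "B \<times> {..<n} \<subseteq> I" and P: "P \<ge> 0"
  defines "S \<equiv> (\<Sum>b\<in>B. (v b)\<^sup>2) * P"
  shows "(\<integral>\<^sup>+\<omega>. ennreal (\<Prod>i<n. exp (P * (\<Sum>b\<in>B. v b * \<omega> (b, i))\<^sup>2 / (2 * (1 + S))) / sqrt (1 + S))
      \<partial>PiM I (\<lambda>_. gauss)) = 1"
proof -
  let ?u = "\<lambda>\<omega> i. \<Sum>b\<in>B. v b * \<omega> (b, i)"
  let ?J = "B \<times> {..<n}"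
  interpret prob_space "PiM I (\<lambda>_::'b \<times> nat. gauss)" by (rule prob_space_gauss_PiM)
  interpret T: prob_space "PiM {..<n} (\<lambda>_. gauss)" by (rule prob_space_gauss_PiM)
  interpret pair_sigma_finite "PiM I (\<lambda>_::'b \<times> nat. gauss)" "PiM {..<n} (\<lambda>_. gauss)" ..
  have S: "S \<ge> 0" using P by (auto simp: S_def intro!: mult_nonneg_nonneg sum_nonneg)
  have cm[measurable]: "(\<lambda>\<omega>. \<omega> (b, i)) \<in> borel_measurable (PiM I (\<lambda>_. gauss))" if "b \<in> B" "i < n" for b i
    using measurable_component_singleton[of "(b, i)" I "\<lambda>_. gauss"] that B by auto
  have um[measurable]: "(\<lambda>\<omega>. ?u \<omega> i) \<in> borel_measurable (PiM I (\<lambda>_. gauss))" if "i < n" for i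
    using that by measurable
  have "(\<integral>\<^sup>+\<omega>. ennreal (\<Prod>i<n. exp (P * (?u \<omega> i)\<^sup>2 / (2 * (1 + S))) / sqrt (1 + S)) \<partial>PiM I (\<lambda>_. gauss))
     = (\<integral>\<^sup>+\<omega>. (\<integral>\<^sup>+t. (\<Prod>i<n. ennreal (exp (t i * (sqrt P * ?u \<omega> i) - (t i)\<^sup>2 * S / 2))) \<partial>PiM {..<n} (\<lambda>_. gauss)) \<partial>PiM I (\<lambda>_. gauss))"
  \<comment> \<open>Each factor is written as a mixture over a standard normal amplitude
    \<open>t i\<close>, the input at time \<open>i\<close> being \<open>sqrt P * t i\<close>. After
    Fubini the input is fixed, and its likelihood ratio against pure noise integrates to
    one.\<close>
  proof (rule nn_integral_cong)
    fix \<omega>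
    have "ennreal (\<Prod>i<n. exp (P * (?u \<omega> i)\<^sup>2 / (2 * (1 + S))) / sqrt (1 + S))
       = (\<Prod>i<n. ennreal (exp ((sqrt P * ?u \<omega> i)\<^sup>2 / (2 * (1 + S))) / sqrt (1 + S)))"
      using S P by (subst prod_ennreal) (auto simp: power_mult_distrib)
    also have "\<dots> = (\<Prod>i<n. \<integral>\<^sup>+t. ennreal (exp (t * (sqrt P * ?u \<omega> i) - t\<^sup>2 * S / 2)) \<partial>gauss)"
      using S by (simp add: nn_integral_gauss_exp_quadratic)
    also have "\<dots> = (\<integral>\<^sup>+t. (\<Prod>i<n. ennreal (exp (t i * (sqrt P * ?u \<omega> i) - (t i)\<^sup>2 * S / 2))) \<partial>PiM {..<n} (\<lambda>_. gauss))"
      by (subst gauss_PiM.product_nn_integral_prod) auto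
    finally show "ennreal (\<Prod>i<n. exp (P * (?u \<omega> i)\<^sup>2 / (2 * (1 + S))) / sqrt (1 + S))
      = (\<integral>\<^sup>+t. (\<Prod>i<n. ennreal (exp (t i * (sqrt P * ?u \<omega> i) - (t i)\<^sup>2 * S / 2))) \<partial>PiM {..<n} (\<lambda>_. gauss))" .
  qed
  also have "\<dots> = (\<integral>\<^sup>+t. (\<integral>\<^sup>+\<omega>. (\<Prod>i<n. ennreal (exp (t i * (sqrt P * ?u \<omega> i) - (t i)\<^sup>2 * S / 2))) \<partial>PiM I (\<lambda>_. gauss)) \<partial>PiM {..<n} (\<lambda>_. gauss))"
    by (rule Fubini'[symmetric]) measurable
  also have "\<dots> = (\<integral>\<^sup>+t. 1 \<partial>PiM {..<n} (\<lambda>_. gauss))"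
  proof (rule nn_integral_cong)
    fix t :: "nat \<Rightarrow> real"
    \<comment> \<open>The sign is negative because the translation formula has the weight
      \<open>exp (- (a z + a^2 / 2))\<close>; shifting by minus the signal produces the likelihood
      ratio of the signal.\<close>
    define a where "a = (\<lambda>(b, i). - (v b * sqrt P * t i))"
    have "(\<Prod>i<n. ennreal (exp (t i * (sqrt P * ?u \<omega> i) - (t i)\<^sup>2 * S / 2)))
       = ennreal (exp (- (\<Sum>j\<in>?J. a j * \<omega> j + (a j)\<^sup>2 / 2)))" for \<omega>
    proof -
      have "(\<Sum>j\<in>?J. a j * \<omega> j + (a j)\<^sup>2 / 2)
         = (\<Sum>i<n. \<Sum>b\<in>B. - (v b * sqrt P * t i) * \<omega> (b, i) + (v b)\<^sup>2 * P * (t i)\<^sup>2 / 2)"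
        unfolding sum.cartesian_product' using P
        by (subst sum.swap) (simp add: a_def power_mult_distrib sum.cartesian_product)
      also have "\<dots> = - (\<Sum>i<n. t i * (sqrt P * ?u \<omega> i) - (t i)\<^sup>2 * S / 2)"
        by (simp add: S_def sum.distrib sum_negf sum_subtractf sum_distrib_left sum_distrib_right sum_divide_distrib mult_ac)
      finally show ?thesis
        by (simp add: prod_ennreal exp_sum)
    qed
    then have "(\<integral>\<^sup>+\<omega>. (\<Prod>i<n. ennreal (exp (t i * (sqrt P * ?u \<omega> i) - (t i)\<^sup>2 * S / 2))) \<partial>PiM I (\<lambda>_. gauss))
       = (\<integral>\<^sup>+\<omega>. 1 * ennreal (exp (- (\<Sum>j\<in>?J. a j * \<omega> j + (a j)\<^sup>2 / 2))) \<partial>PiM I (\<lambda>_. gauss))"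
      by simp
    also have "\<dots> = (\<integral>\<^sup>+\<omega>. 1 \<partial>PiM I (\<lambda>_. gauss))"
      using nn_integral_gauss_PiM_adapted_shift[OF I B(2), of "\<lambda>_. a" "\<lambda>_. 1"] by simp
    finally show "(\<integral>\<^sup>+\<omega>. (\<Prod>i<n. ennreal (exp (t i * (sqrt P * ?u \<omega> i) - (t i)\<^sup>2 * S / 2))) \<partial>PiM I (\<lambda>_. gauss)) = 1"
      by (simp add: emeasure_space_1)
  qed
  also have "\<dots> = 1" by (simp add: T.emeasure_space_1)
  finally show ?thesis .
qed

section \<open>A converse for one input observed through several Gaussian channels\<close>

text \<open>Channel \<open>b\<close> sees the common input through the gain \<open>v b\<close>. The
  index set \<open>I\<close> may exceed the block \<open>B \<times> {..<n}\<close>: the remaining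
  coordinates carry noise that is not part of this observation, on which the input or the decoders
  may still depend.\<close>

locale gaussian_block =
  fixes I :: "('b \<times> nat) set" and B :: "'b set" and n :: nat and v :: "'b \<Rightarrow> real" and P :: real
  assumes finite_I: "finite I" and finite_B: "finite B" and block_subset: "B \<times> {..<n} \<subseteq> I"
    and P_nonneg: "P \<ge> 0"
begin

abbreviation noise :: "('b \<times> nat \<Rightarrow> real) measure" where
  "noise \<equiv> PiM I (\<lambda>_. gauss)"

definition gain :: real where "gain = (\<Sum>b\<in>B. (v b)\<^sup>2)"

definition snr :: real where "snr = gain * P"

definition proj :: "('b \<times> nat \<Rightarrow> real) \<Rightarrow> nat \<Rightarrow> real" where
  "proj \<omega> i = (\<Sum>b\<in>B. v b * \<omega> (b, i))"

text \<open>Density of the reference output law Q with respect to the noise law, where Q arises from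
  independent N(0, P) inputs. It depends on the output only through \<open>proj\<close>, the
  sufficient statistic for the input.\<close>

definition out_density :: "('b \<times> nat \<Rightarrow> real) \<Rightarrow> real" where
  "out_density \<omega> = (\<Prod>i<n. exp (P * (proj \<omega> i)\<^sup>2 / (2 * (1 + snr))) / sqrt (1 + snr))"

text \<open>Each output overwrites the noise sample it contains. This makes
  \<open>received x\<close> a map of the noise space into itself, as in the translation formula, and
  an event about outputs becomes an event in the noise space.\<close>

definition received :: "(('b \<times> nat \<Rightarrow> real) \<Rightarrow> nat \<Rightarrow> real) \<Rightarrow> ('b \<times> nat \<Rightarrow> real) \<Rightarrow> 'b \<times> nat \<Rightarrow> real" where
  "received x \<omega> = (\<lambda>k\<in>I. if k \<in> B \<times> {..<n} then \<omega> k + v (fst k) * x \<omega> (snd k) else \<omega> k)"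

text \<open>Log-likelihood ratio of the output law for input \<open>x\<close> against Q, evaluated
  at the received output and rewritten in terms of input and noise. The projection of the output is
  \<open>gain * x \<omega> i + proj \<omega> i\<close>, which is why the quadratic term in the input
  carries a plus sign.\<close>

definition info_density :: "(('b \<times> nat \<Rightarrow> real) \<Rightarrow> nat \<Rightarrow> real) \<Rightarrow> ('b \<times> nat \<Rightarrow> real) \<Rightarrow> real" where
  "info_density x \<omega> = (\<Sum>i<n. x \<omega> i * proj \<omega> i + gain * (x \<omega> i)\<^sup>2 / 2 + ln (1 + snr) / 2
      - P * (gain * x \<omega> i + proj \<omega> i)\<^sup>2 / (2 * (1 + snr)))"

text \<open>Independence of the input from the noise in the block is encoded functionally: the input
  may read only coordinates outside the block.\<close>

definition block_input :: "(('b \<times> nat \<Rightarrow> real) \<Rightarrow> nat \<Rightarrow> real) \<Rightarrow> bool" where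
  "block_input x \<longleftrightarrow> (\<forall>i<n. (\<lambda>\<omega>. x \<omega> i) \<in> borel_measurable noise)
    \<and> (\<forall>i<n. \<forall>\<omega> \<omega>'. (\<forall>k\<in>I - B \<times> {..<n}. \<omega> k = \<omega>' k) \<longrightarrow> x \<omega> i = x \<omega>' i)"

lemma block_input_measurable [measurable]:
  "block_input x \<Longrightarrow> i < n \<Longrightarrow> (\<lambda>\<omega>. x \<omega> i) \<in> borel_measurable noise"
  by (simp add: block_input_def)

lemma gain_nonneg: "gain \<ge> 0" by (auto simp: gain_def intro!: sum_nonneg)

lemma snr_nonneg: "snr \<ge> 0" using gain_nonneg P_nonneg by (simp add: snr_def)

lemma component_measurable [measurable]:
  "b \<in> B \<Longrightarrow> i < n \<Longrightarrow> (\<lambda>\<omega>. \<omega> (b, i)) \<in> borel_measurable noise"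
  using measurable_component_singleton[of "(b, i)" I "\<lambda>_. gauss"] block_subset by auto

lemma proj_measurable [measurable]: "i < n \<Longrightarrow> (\<lambda>\<omega>. proj \<omega> i) \<in> borel_measurable noise"
  unfolding proj_def by measurable

lemma out_density_measurable [measurable]: "out_density \<in> borel_measurable noise"
  unfolding out_density_def by measurable

lemma info_density_measurable [measurable]:
  "block_input x \<Longrightarrow> info_density x \<in> borel_measurable noise"
  unfolding info_density_def by measurable

lemma received_measurable [measurable]:
  assumes "block_input x"
  shows "received x \<in> measurable noise noise"
  unfolding received_def
proof (rule measurable_restrict)
  fix k assume "k \<in> I"
  then show "(\<lambda>\<omega>. if k \<in> B \<times> {..<n} then \<omega> k + v (fst k) * x \<omega> (snd k) else \<omega> k) \<in> measurable noise gauss"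
    using assms measurable_component_singleton[of k I "\<lambda>_. gauss"]
    by (cases "k \<in> B \<times> {..<n}") auto
qed

lemma nn_integral_out_density: "(\<integral>\<^sup>+\<omega>. ennreal (out_density \<omega>) \<partial>noise) = 1"
  unfolding out_density_def proj_def snr_def gain_def
  by (rule nn_integral_gauss_output_density[OF finite_I finite_B block_subset P_nonneg])

lemma out_density_nonneg: "out_density \<omega> \<ge> 0"
  using snr_nonneg by (auto simp: out_density_def intro!: prod_nonneg)

text \<open>The first factor is a function of the output alone and the second is the Cameron-Martin
  weight of the shift in \<open>received\<close>, so the translation formula can be applied.\<close>

lemma exp_info_density:
  "exp (- info_density x \<omega>) = out_density (received x \<omega>)
     * exp (- (\<Sum>k\<in>B \<times> {..<n}. v (fst k) * x \<omega> (snd k) * \<omega> k + (v (fst k) * x \<omega> (snd k))\<^sup>2 / 2))"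
proof -
  have s: "1 + snr > 0" using snr_nonneg by simp
  have p: "proj (received x \<omega>) i = gain * x \<omega> i + proj \<omega> i" if "i < n" for i
  proof -
    have "proj (received x \<omega>) i = (\<Sum>b\<in>B. v b * (\<omega> (b, i) + v b * x \<omega> i))"
      unfolding proj_def received_def using that block_subset by (intro sum.cong) auto
    then show ?thesis
      by (simp add: proj_def gain_def algebra_simps sum.distrib sum_distrib_left power2_eq_square)
  qed
  have "out_density (received x \<omega>)
      = exp (\<Sum>i<n. P * (gain * x \<omega> i + proj \<omega> i)\<^sup>2 / (2 * (1 + snr)) - ln (1 + snr) / 2)"
    unfolding out_density_def exp_sum[OF finite_lessThan] using s
    by (intro prod.cong) (auto simp: p exp_diff ln_sqrt[symmetric])
  moreover have "(\<Sum>k\<in>B \<times> {..<n}. v (fst k) * x \<omega> (snd k) * \<omega> k + (v (fst k) * x \<omega> (snd k))\<^sup>2 / 2)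
      = (\<Sum>i<n. x \<omega> i * proj \<omega> i + gain * (x \<omega> i)\<^sup>2 / 2)"
  proof -
    have "(\<Sum>k\<in>B \<times> {..<n}. v (fst k) * x \<omega> (snd k) * \<omega> k + (v (fst k) * x \<omega> (snd k))\<^sup>2 / 2)
        = (\<Sum>i<n. \<Sum>b\<in>B. v b * x \<omega> i * \<omega> (b, i) + (v b * x \<omega> i)\<^sup>2 / 2)"
      unfolding sum.cartesian_product' by (subst sum.swap) (simp add: sum.cartesian_product)
    also have "\<dots> = (\<Sum>i<n. x \<omega> i * proj \<omega> i + gain * (x \<omega> i)\<^sup>2 / 2)"
      by (simp add: proj_def gain_def sum.distrib sum_distrib_left sum_distrib_right
          sum_divide_distrib power_mult_distrib mult_ac)
    finally show ?thesis .
  qed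
  ultimately show ?thesis
    by (simp add: info_density_def mult_exp_exp sum.distrib sum_subtractf)
qed

text \<open>Under the weight \<open>exp (- info_density x \<omega>)\<close> the output has law Q
  whatever the input is. Hence it carries no information about the message, which is what limits
  correct decoding in \<open>converse\<close>.\<close>

lemma nn_integral_change_of_measure:
  assumes x: "block_input x" and [measurable]: "F \<in> borel_measurable noise"
  shows "(\<integral>\<^sup>+\<omega>. ennreal (exp (- info_density x \<omega>)) * F (received x \<omega>) \<partial>noise)
     = (\<integral>\<^sup>+\<omega>. ennreal (out_density \<omega>) * F \<omega> \<partial>noise)"
proof -
  let ?a = "\<lambda>\<omega> k. v (fst k) * x \<omega> (snd k)"
  have "(\<integral>\<^sup>+\<omega>. ennreal (exp (- info_density x \<omega>)) * F (received x \<omega>) \<partial>noise)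
      = (\<integral>\<^sup>+\<omega>. (ennreal (out_density (received x \<omega>)) * F (received x \<omega>))
          * ennreal (exp (- (\<Sum>k\<in>B \<times> {..<n}. ?a \<omega> k * \<omega> k + (?a \<omega> k)\<^sup>2 / 2))) \<partial>noise)"
    unfolding exp_info_density by (intro nn_integral_cong) (simp add: ennreal_mult'' mult_ac)
  also have "\<dots> = (\<integral>\<^sup>+\<omega>. ennreal (out_density \<omega>) * F \<omega> \<partial>noise)"
    unfolding received_def
  proof (rule nn_integral_gauss_PiM_adapted_shift[OF finite_I block_subset, where a="?a" and F="\<lambda>\<omega>. ennreal (out_density \<omega>) * F \<omega>"])
    fix k assume "k \<in> B \<times> {..<n}"
    then show "(\<lambda>\<omega>. ?a \<omega> k) \<in> borel_measurable noise" using x by auto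
  next
    fix \<omega> \<omega>' :: "'b \<times> nat \<Rightarrow> real" and k
    assume k: "k \<in> B \<times> {..<n}" and "\<forall>k\<in>I - B \<times> {..<n}. \<omega> k = \<omega>' k"
    moreover have "snd k < n" using k by auto
    ultimately have "x \<omega> (snd k) = x \<omega>' (snd k)" using x unfolding block_input_def by blast
    then show "?a \<omega> k = ?a \<omega>' k" by simp
  qed measurable
  finally show ?thesis .
qed

section \<open>Mean of the information density\<close>

lemma component_orthogonal:
  assumes b: "b \<in> B" "i < n" and x: "block_input x" and sq: "integrable noise (\<lambda>\<omega>. (x \<omega> i)\<^sup>2)"
  shows "integrable noise (\<lambda>\<omega>. x \<omega> i * \<omega> (b, i))" and "(\<integral>\<omega>. x \<omega> i * \<omega> (b, i) \<partial>noise) = 0"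
proof -
  have bi: "(b, i) \<in> I" using b block_subset by auto
  have dep: "x (fun_upd \<omega> (b, i) t) i = x \<omega> i" for \<omega> t
  proof -
    have "\<forall>k\<in>I - B \<times> {..<n}. (fun_upd \<omega> (b, i) t) k = \<omega> k" using b by auto
    then show ?thesis using x b(2) unfolding block_input_def by blast
  qed
  show "integrable noise (\<lambda>\<omega>. x \<omega> i * \<omega> (b, i))" "(\<integral>\<omega>. x \<omega> i * \<omega> (b, i) \<partial>noise) = 0"
    using integral_gauss_PiM_orthogonal[OF finite_I bi, of "\<lambda>\<omega>. x \<omega> i"] block_input_measurable[OF x b(2)] sq dep
    by auto
qed

lemma component_covariance:
  assumes b: "b \<in> B" "b' \<in> B" "i < n"
  shows "integrable noise (\<lambda>\<omega>. \<omega> (b, i) * \<omega> (b', i))"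
    and "(\<integral>\<omega>. \<omega> (b, i) * \<omega> (b', i) \<partial>noise) = (if b = b' then 1 else 0)"
proof -
  have bi: "(b, i) \<in> I" "(b', i) \<in> I" using b block_subset by auto
  note sq = integrable_gauss_PiM_component[OF bi(1), of "\<lambda>z. z\<^sup>2"] integral_gauss_PiM_component[OF bi(1), of "\<lambda>z. z\<^sup>2"]
  have "integrable noise (\<lambda>\<omega>. \<omega> (b, i) * \<omega> (b', i)) \<and>
     (\<integral>\<omega>. \<omega> (b, i) * \<omega> (b', i) \<partial>noise) = (if b = b' then 1 else 0)"
  proof (cases "b = b'")
    case True
    then show ?thesis using sq by (simp add: power2_eq_square[symmetric] integrable_gauss_square integral_gauss_square)
  next
    case False
    then show ?thesis
      using integral_gauss_PiM_orthogonal[OF finite_I bi(2), of "\<lambda>\<omega>. \<omega> (b, i)"] component_measurable[OF b(1,3)]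
        sq integrable_gauss_square by auto
  qed
  then show "integrable noise (\<lambda>\<omega>. \<omega> (b, i) * \<omega> (b', i))"
    "(\<integral>\<omega>. \<omega> (b, i) * \<omega> (b', i) \<partial>noise) = (if b = b' then 1 else 0)" by auto
qed

lemma proj_moments:
  assumes i: "i < n" and x: "block_input x" and sq: "integrable noise (\<lambda>\<omega>. (x \<omega> i)\<^sup>2)"
  shows "integrable noise (\<lambda>\<omega>. (proj \<omega> i)\<^sup>2)" and "(\<integral>\<omega>. (proj \<omega> i)\<^sup>2 \<partial>noise) = gain"
    and "integrable noise (\<lambda>\<omega>. x \<omega> i * proj \<omega> i)" and "(\<integral>\<omega>. x \<omega> i * proj \<omega> i \<partial>noise) = 0"
proof -
  have e: "(proj \<omega> i)\<^sup>2 = (\<Sum>b\<in>B. \<Sum>b'\<in>B. v b * v b' * (\<omega> (b, i) * \<omega> (b', i)))" for \<omega>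
    by (simp add: proj_def power2_eq_square sum_product mult_ac)
  have e': "x \<omega> i * proj \<omega> i = (\<Sum>b\<in>B. v b * (x \<omega> i * \<omega> (b, i)))" for \<omega>
    by (simp add: proj_def sum_distrib_left mult_ac)
  note c = component_covariance[OF _ _ i] component_orthogonal[OF _ i x sq]
  show "integrable noise (\<lambda>\<omega>. (proj \<omega> i)\<^sup>2)" unfolding e using c by auto
  have "(\<integral>\<omega>. (proj \<omega> i)\<^sup>2 \<partial>noise)
      = (\<Sum>b\<in>B. \<integral>\<omega>. (\<Sum>b'\<in>B. v b * v b' * (\<omega> (b, i) * \<omega> (b', i))) \<partial>noise)"
    unfolding e using c by (intro Bochner_Integration.integral_sum) auto
  also have "\<dots> = (\<Sum>b\<in>B. \<Sum>b'\<in>B. \<integral>\<omega>. v b * v b' * (\<omega> (b, i) * \<omega> (b', i)) \<partial>noise)"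
    using c by (intro sum.cong refl Bochner_Integration.integral_sum) auto
  also have "\<dots> = (\<Sum>b\<in>B. \<Sum>b'\<in>B. if b = b' then v b * v b' else 0)"
    using c by (intro sum.cong refl) auto
  also have "\<dots> = gain"
    using finite_B by (simp add: gain_def power2_eq_square)
  finally show "(\<integral>\<omega>. (proj \<omega> i)\<^sup>2 \<partial>noise) = gain" .
  show "integrable noise (\<lambda>\<omega>. x \<omega> i * proj \<omega> i)" unfolding e' using c by auto
  show "(\<integral>\<omega>. x \<omega> i * proj \<omega> i \<partial>noise) = 0"
    unfolding e' using c by (subst Bochner_Integration.integral_sum) auto
qed

text \<open>After expanding the square, the cross term has mean zero since the input is independent
  of the block's noise, and the squared projection has mean \<open>gain\<close>. At total power
  \<open>n * P\<close> the first two terms cancel and only the capacity term is left; this is the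
  effect of matching Q to the power constraint.\<close>

lemma integral_info_density:
  assumes x: "block_input x" and sq: "\<And>i. i < n \<Longrightarrow> integrable noise (\<lambda>\<omega>. (x \<omega> i)\<^sup>2)"
  shows "integrable noise (info_density x)"
    and "(\<integral>\<omega>. info_density x \<omega> \<partial>noise) = gain / (2 * (1 + snr)) * (\<Sum>i<n. \<integral>\<omega>. (x \<omega> i)\<^sup>2 \<partial>noise)
        - real n * (snr / (2 * (1 + snr))) + real n / 2 * ln (1 + snr)"
proof -
  interpret prob_space noise by (rule prob_space_gauss_PiM)
  let ?c = "P / (2 * (1 + snr))"
  have s: "1 + snr > 0" using snr_nonneg by simp
  have e: "info_density x \<omega> = (\<Sum>i<n. gain / (2 * (1 + snr)) * (x \<omega> i)\<^sup>2 + (1 - 2 * ?c * gain) * (x \<omega> i * proj \<omega> i)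
       - ?c * (proj \<omega> i)\<^sup>2 + ln (1 + snr) / 2)" for \<omega>
    unfolding info_density_def
  proof (intro sum.cong refl)
    fix i
    define y u r where "y = x \<omega> i" and "u = proj \<omega> i" and "r = 1 + snr"
    have r: "r > 0" "gain * P = r - 1" using s by (auto simp: r_def snr_def)
    have "y * u + gain * y\<^sup>2 / 2 - P * (gain * y + u)\<^sup>2 / (2 * r)
        = (y * u + gain * y\<^sup>2 / 2) - ((gain * P) * gain * y\<^sup>2 + 2 * (gain * P) * y * u + P * u\<^sup>2) / (2 * r)"
      by (simp add: power2_eq_square algebra_simps)
    also have "\<dots> = gain / (2 * r) * y\<^sup>2 + (1 - 2 * (gain * P) / (2 * r)) * (y * u) - P / (2 * r) * u\<^sup>2"
      unfolding r(2) using r(1) by (simp add: field_simps)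
    finally show "x \<omega> i * proj \<omega> i + gain * (x \<omega> i)\<^sup>2 / 2 + ln (1 + snr) / 2
      - P * (gain * x \<omega> i + proj \<omega> i)\<^sup>2 / (2 * (1 + snr))
      = gain / (2 * (1 + snr)) * (x \<omega> i)\<^sup>2 + (1 - 2 * ?c * gain) * (x \<omega> i * proj \<omega> i)
       - ?c * (proj \<omega> i)\<^sup>2 + ln (1 + snr) / 2"
      unfolding y_def u_def r_def by (simp add: mult_ac)
  qed
  note m = proj_moments[OF _ x sq]
  show "integrable noise (info_density x)"
    unfolding e using sq m by auto
  have "(\<integral>\<omega>. info_density x \<omega> \<partial>noise) = (\<Sum>i<n. \<integral>\<omega>. gain / (2 * (1 + snr)) * (x \<omega> i)\<^sup>2 + (1 - 2 * ?c * gain) * (x \<omega> i * proj \<omega> i)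
       - ?c * (proj \<omega> i)\<^sup>2 + ln (1 + snr) / 2 \<partial>noise)"
    unfolding e using sq m by (intro Bochner_Integration.integral_sum) auto
  also have "\<dots> = (\<Sum>i<n. gain / (2 * (1 + snr)) * (\<integral>\<omega>. (x \<omega> i)\<^sup>2 \<partial>noise) - snr / (2 * (1 + snr)) + ln (1 + snr) / 2)"
  proof (intro sum.cong refl)
    fix i assume i: "i \<in> {..<n}"
    have "(\<integral>\<omega>. \<alpha> * (x \<omega> i)\<^sup>2 + \<beta> * (x \<omega> i * proj \<omega> i) - \<gamma> * (proj \<omega> i)\<^sup>2 + \<delta> \<partial>noise)
        = \<alpha> * (\<integral>\<omega>. (x \<omega> i)\<^sup>2 \<partial>noise) - \<gamma> * gain + \<delta>" for \<alpha> \<beta> \<gamma> \<delta> :: real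
      using i sq[of i] m[of i] by (simp add: prob_space)
    note this[of "gain / (2 * (1 + snr))" "1 - 2 * ?c * gain" ?c "ln (1 + snr) / 2"]
    moreover have "?c * gain = snr / (2 * (1 + snr))" by (simp add: snr_def)
    ultimately show "(\<integral>\<omega>. gain / (2 * (1 + snr)) * (x \<omega> i)\<^sup>2 + (1 - 2 * ?c * gain) * (x \<omega> i * proj \<omega> i)
       - ?c * (proj \<omega> i)\<^sup>2 + ln (1 + snr) / 2 \<partial>noise)
      = gain / (2 * (1 + snr)) * (\<integral>\<omega>. (x \<omega> i)\<^sup>2 \<partial>noise) - snr / (2 * (1 + snr)) + ln (1 + snr) / 2"
      by simp
  qed
  also have "\<dots> = gain / (2 * (1 + snr)) * (\<Sum>i<n. \<integral>\<omega>. (x \<omega> i)\<^sup>2 \<partial>noise)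
        - real n * (snr / (2 * (1 + snr))) + real n / 2 * ln (1 + snr)"
    by (simp add: sum.distrib sum_subtractf sum_distrib_left)
  finally show "(\<integral>\<omega>. info_density x \<omega> \<partial>noise) = gain / (2 * (1 + snr)) * (\<Sum>i<n. \<integral>\<omega>. (x \<omega> i)\<^sup>2 \<partial>noise)
        - real n * (snr / (2 * (1 + snr))) + real n / 2 * ln (1 + snr)" .
qed

text \<open>\<open>card_G\<close> says that any single output lies in the success sets of at most a
  fraction \<open>1 / M\<close> of the messages. This bounds the average probability of success
  under Q by \<open>1 / M\<close>. Power and success are summed over \<open>w\<close>, since the
  constraints hold only on average over messages.\<close>

lemma converse:
  fixes W :: "'w set" and x :: "'w \<Rightarrow> ('b \<times> nat \<Rightarrow> real) \<Rightarrow> nat \<Rightarrow> real" and M :: real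
  assumes W: "finite W" and M: "M \<ge> 1"
    and x: "\<And>w. w \<in> W \<Longrightarrow> block_input (x w)"
    and power: "(\<Sum>i<n. \<Sum>w\<in>W. \<integral>\<^sup>+\<omega>. ennreal ((x w \<omega> i)\<^sup>2) \<partial>noise) \<le> ennreal (real n * real (card W) * P)"
    and G: "\<And>w. w \<in> W \<Longrightarrow> G w \<in> sets noise"
    and card_G: "\<And>\<omega>. \<omega> \<in> space noise \<Longrightarrow> real (card {w \<in> W. \<omega> \<in> G w}) * M \<le> real (card W)"
  shows "(\<Sum>w\<in>W. measure noise {\<omega> \<in> space noise. received (x w) \<omega> \<in> G w}) * ln M
      \<le> real (card W) * (real n / 2 * ln (1 + snr) + ln 2)"
proof -
  interpret prob_space noise by (rule prob_space_gauss_PiM)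
  let ?A = "\<lambda>w. {\<omega> \<in> space noise. received (x w) \<omega> \<in> G w}"
  let ?T = "\<lambda>w. info_density (x w)"
  \<comment> \<open>The factor equals \<open>M\<close> on success and 1 otherwise, so its logarithm
    is \<open>ln M\<close> times the indicator of success.\<close>
  let ?g = "\<lambda>w \<omega>. 1 + (M - 1) * indicator (G w) \<omega> :: real"
  define Y where "Y = (\<lambda>w \<omega>. exp (- ?T w \<omega>) * ?g w (received (x w) \<omega>))"
  note [measurable] = G x
  have s: "1 + snr > 0" using snr_nonneg by simp
  \<comment> \<open>Each second moment is a summand of the total power, which is finite.\<close>
  have sq: "integrable noise (\<lambda>\<omega>. (x w \<omega> i)\<^sup>2)" if "w \<in> W" "i < n" for w i
  proof (rule integrableI_nonneg)
    have "(\<integral>\<^sup>+\<omega>. ennreal ((x w \<omega> i)\<^sup>2) \<partial>noise) \<le> (\<Sum>w\<in>W. \<integral>\<^sup>+\<omega>. ennreal ((x w \<omega> i)\<^sup>2) \<partial>noise)"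
      using W that by (intro member_le_sum) auto
    also have "\<dots> \<le> (\<Sum>i<n. \<Sum>w\<in>W. \<integral>\<^sup>+\<omega>. ennreal ((x w \<omega> i)\<^sup>2) \<partial>noise)"
      using that by (intro member_le_sum[where f="\<lambda>i. \<Sum>w\<in>W. \<integral>\<^sup>+\<omega>. ennreal ((x w \<omega> i)\<^sup>2) \<partial>noise"]) auto
    also have "\<dots> < \<infinity>" using power by (rule le_less_trans) simp
    finally show "(\<integral>\<^sup>+\<omega>. ennreal ((x w \<omega> i)\<^sup>2) \<partial>noise) < \<infinity>" .
  qed (use that in auto)
  have pw: "(\<Sum>w\<in>W. \<Sum>i<n. \<integral>\<omega>. (x w \<omega> i)\<^sup>2 \<partial>noise) \<le> real n * real (card W) * P"
  proof -
    have "ennreal (\<Sum>i<n. \<Sum>w\<in>W. \<integral>\<omega>. (x w \<omega> i)\<^sup>2 \<partial>noise) = (\<Sum>i<n. \<Sum>w\<in>W. \<integral>\<^sup>+\<omega>. ennreal ((x w \<omega> i)\<^sup>2) \<partial>noise)"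
      using sq by (simp add: sum_nonneg nn_integral_eq_integral)
    with power have "(\<Sum>i<n. \<Sum>w\<in>W. \<integral>\<omega>. (x w \<omega> i)\<^sup>2 \<partial>noise) \<le> real n * real (card W) * P"
      using P_nonneg by (subst ennreal_le_iff[symmetric]) auto
    then show ?thesis by (subst sum.swap)
  qed
  \<comment> \<open>The mean of the information density is affine in the input power, so a
    constraint averaged over messages and time suffices.\<close>
  have T: "(\<Sum>w\<in>W. \<integral>\<omega>. ?T w \<omega> \<partial>noise) \<le> real (card W) * (real n / 2 * ln (1 + snr))"
  proof -
    have "(\<Sum>w\<in>W. \<integral>\<omega>. ?T w \<omega> \<partial>noise) = (\<Sum>w\<in>W. gain / (2 * (1 + snr)) * (\<Sum>i<n. \<integral>\<omega>. (x w \<omega> i)\<^sup>2 \<partial>noise)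
        - real n * (snr / (2 * (1 + snr))) + real n / 2 * ln (1 + snr))"
      using x sq by (intro sum.cong refl integral_info_density(2)) auto
    also have "\<dots> = gain / (2 * (1 + snr)) * (\<Sum>w\<in>W. \<Sum>i<n. \<integral>\<omega>. (x w \<omega> i)\<^sup>2 \<partial>noise)
        - real (card W) * (real n * (snr / (2 * (1 + snr)))) + real (card W) * (real n / 2 * ln (1 + snr))"
      by (simp add: sum.distrib sum_subtractf sum_distrib_left)
    also have "gain / (2 * (1 + snr)) * (\<Sum>w\<in>W. \<Sum>i<n. \<integral>\<omega>. (x w \<omega> i)\<^sup>2 \<partial>noise)
        \<le> gain / (2 * (1 + snr)) * (real n * real (card W) * P)"
      using gain_nonneg s pw by (intro mult_left_mono) auto
    also have "\<dots> = real (card W) * (real n * (snr / (2 * (1 + snr))))" by (simp add: snr_def)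
    finally show ?thesis by simp
  qed
  have Ym: "Y w \<in> borel_measurable noise" if "w \<in> W" for w
    using that unfolding Y_def by measurable
  have Y0: "Y w \<omega> \<ge> 0" for w \<omega> using M by (auto simp: Y_def)
  have Yint: "(\<integral>\<^sup>+\<omega>. ennreal (Y w \<omega>) \<partial>noise) = (\<integral>\<^sup>+\<omega>. ennreal (out_density \<omega>) * ennreal (?g w \<omega>) \<partial>noise)"
    if w: "w \<in> W" for w
  proof -
    have "(\<integral>\<^sup>+\<omega>. ennreal (Y w \<omega>) \<partial>noise)
       = (\<integral>\<^sup>+\<omega>. ennreal (exp (- ?T w \<omega>)) * ennreal (?g w (received (x w) \<omega>)) \<partial>noise)"
      using M by (intro nn_integral_cong) (simp add: Y_def ennreal_mult)
    also have "\<dots> = (\<integral>\<^sup>+\<omega>. ennreal (out_density \<omega>) * ennreal (?g w \<omega>) \<partial>noise)"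
      using w by (intro nn_integral_change_of_measure[OF x]) measurable
    finally show ?thesis .
  qed
  have "(\<Sum>w\<in>W. \<integral>\<^sup>+\<omega>. ennreal (Y w \<omega>) \<partial>noise)
      = (\<integral>\<^sup>+\<omega>. (\<Sum>w\<in>W. ennreal (out_density \<omega>) * ennreal (?g w \<omega>)) \<partial>noise)"
    by (subst nn_integral_sum) (auto simp: Yint)
  also have "\<dots> \<le> (\<integral>\<^sup>+\<omega>. ennreal (2 * real (card W)) * ennreal (out_density \<omega>) \<partial>noise)"
  proof (rule nn_integral_mono)
    fix \<omega> assume \<omega>: "\<omega> \<in> space noise"
    \<comment> \<open>For one fixed output the successes add at most \<open>card W\<close> in total,
      because there are at most \<open>card W / M\<close> of them.\<close>
    have "(\<Sum>w\<in>W. ?g w \<omega>) = real (card W) + (M - 1) * real (card {w \<in> W. \<omega> \<in> G w})"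
      using W by (simp add: sum.distrib sum_distrib_left[symmetric] indicator_def sum.If_cases Collect_conj_eq Int_commute)
    also have "\<dots> \<le> 2 * real (card W)"
      using card_G[OF \<omega>] by (simp add: algebra_simps)
    finally have "(\<Sum>w\<in>W. ?g w \<omega>) \<le> 2 * real (card W)" .
    moreover have "(\<Sum>w\<in>W. ennreal (?g w \<omega>)) = ennreal (\<Sum>w\<in>W. ?g w \<omega>)"
      using M by (intro sum_ennreal) auto
    ultimately have "(\<Sum>w\<in>W. ennreal (?g w \<omega>)) \<le> ennreal (2 * real (card W))"
      by (simp add: ennreal_leI)
    then show "(\<Sum>w\<in>W. ennreal (out_density \<omega>) * ennreal (?g w \<omega>)) \<le> ennreal (2 * real (card W)) * ennreal (out_density \<omega>)"
      unfolding sum_distrib_left[symmetric] by (subst mult.commute) (rule mult_right_mono, auto)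
  qed
  also have "\<dots> = ennreal (2 * real (card W))"
    by (subst nn_integral_cmult) (auto simp: nn_integral_out_density)
  finally have Ysum: "(\<Sum>w\<in>W. \<integral>\<^sup>+\<omega>. ennreal (Y w \<omega>) \<partial>noise) \<le> ennreal (2 * real (card W))" .
  have Yi: "integrable noise (Y w)" if "w \<in> W" for w
  proof (rule integrableI_nonneg)
    have "(\<integral>\<^sup>+\<omega>. ennreal (Y w \<omega>) \<partial>noise) \<le> (\<Sum>w\<in>W. \<integral>\<^sup>+\<omega>. ennreal (Y w \<omega>) \<partial>noise)"
      using W that by (intro member_le_sum) auto
    also have "\<dots> < \<infinity>" using Ysum by (rule le_less_trans) simp
    finally show "(\<integral>\<^sup>+\<omega>. ennreal (Y w \<omega>) \<partial>noise) < \<infinity>" .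
  qed (use that Ym Y0 in auto)
  have Ysum': "(\<Sum>w\<in>W. \<integral>\<omega>. Y w \<omega> \<partial>noise) \<le> 2 * real (card W)"
  proof -
    have "ennreal (\<Sum>w\<in>W. \<integral>\<omega>. Y w \<omega> \<partial>noise) = (\<Sum>w\<in>W. \<integral>\<^sup>+\<omega>. ennreal (Y w \<omega>) \<partial>noise)"
      using Yi Y0 by (simp add: nn_integral_eq_integral)
    with Ysum show ?thesis by (subst ennreal_le_iff[symmetric]) auto
  qed
  have "measure noise (?A w) * ln M - (\<integral>\<omega>. ?T w \<omega> \<partial>noise) - ln 2 \<le> (\<integral>\<omega>. Y w \<omega> \<partial>noise) / 2 - 1" if w: "w \<in> W" for w
  proof -
    have Am: "?A w \<in> sets noise" using w by measurable
    have Ti: "integrable noise (?T w)" using x sq w by (intro integral_info_density(1)) auto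
    have "measure noise (?A w) * ln M - (\<integral>\<omega>. ?T w \<omega> \<partial>noise) - ln 2
       = (\<integral>\<omega>. indicator (?A w) \<omega> * ln M - ?T w \<omega> - ln 2 \<partial>noise)"
      using Am Ti by (simp add: prob_space emeasure_eq_measure)
    also have "\<dots> \<le> (\<integral>\<omega>. Y w \<omega> / 2 - 1 \<partial>noise)"
    proof (rule integral_mono)
      fix \<omega> assume \<omega>: "\<omega> \<in> space noise"
      define m where "m = (if \<omega> \<in> ?A w then M else 1)"
      have m: "m > 0" "ln m = indicator (?A w) \<omega> * ln M" using M by (auto simp: m_def)
      have Ym': "Y w \<omega> = exp (- ?T w \<omega>) * m" using \<omega> by (auto simp: Y_def m_def)
      \<comment> \<open>The bound \<open>ln r \<le> r - 1\<close> is used at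
        \<open>r = Y / 2\<close>. The average of \<open>Y\<close> over messages and noise is at most
        2, so the right-hand sides sum to at most zero and the normalisation costs only
        \<open>ln 2\<close>.\<close>
      have "ln (exp (- ?T w \<omega>) * m / 2) \<le> exp (- ?T w \<omega>) * m / 2 - 1"
        using m by (intro ln_le_minus_one) auto
      then show "indicator (?A w) \<omega> * ln M - ?T w \<omega> - ln 2 \<le> Y w \<omega> / 2 - 1"
        using m by (simp add: Ym' ln_mult ln_div)
    qed (use Am Ti Yi w in \<open>auto simp: emeasure_eq_measure\<close>)
    also have "\<dots> = (\<integral>\<omega>. Y w \<omega> \<partial>noise) / 2 - 1"
      using Yi w by (simp add: prob_space)
    finally show ?thesis .
  qed
  then have "(\<Sum>w\<in>W. measure noise (?A w) * ln M - (\<integral>\<omega>. ?T w \<omega> \<partial>noise) - ln 2) \<le> (\<Sum>w\<in>W. (\<integral>\<omega>. Y w \<omega> \<partial>noise) / 2 - 1)"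
    by (rule sum_mono)
  then have "(\<Sum>w\<in>W. measure noise (?A w)) * ln M - (\<Sum>w\<in>W. \<integral>\<omega>. ?T w \<omega> \<partial>noise) - real (card W) * ln 2
      \<le> (\<Sum>w\<in>W. \<integral>\<omega>. Y w \<omega> \<partial>noise) / 2 - real (card W)"
    by (simp add: sum_subtractf sum_distrib_right sum_divide_distrib)
  with T Ysum' show ?thesis
    unfolding distrib_left by linarith
qed

end

section \<open>The Y-channel\<close>

lemma noise_space_eq: "noise_space n = PiM ({..3} \<times> {..<n}) (\<lambda>_. gauss)"
  by (simp add: noise_space_def)

lemma pairs_eq: "pairs = {(1,2), (1,3), (2,1), (2,3), (3,1), (3,2)}"
  by (auto simp: pairs_def)

lemma finite_pairs: "finite pairs"
  by (simp add: pairs_eq)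

lemma finite_msg_set: "finite (msg_set n R)"
  unfolding msg_set_def by (intro finite_PiE finite_pairs) auto

lemma msg_size_ge: "real (msg_size n r) \<ge> 2 powr (real n * r)"
  unfolding msg_size_def by linarith

lemma msg_size_pos: "msg_size n r > 0"
proof -
  have "0 < 2 powr (real n * r)" by simp
  also note msg_size_ge
  finally show ?thesis by simp
qed

lemma card_msg_set: "card (msg_set n R) = (\<Prod>jk\<in>pairs. msg_size n (R jk))"
  unfolding msg_set_def by (simp add: card_PiE finite_pairs)

lemma card_msg_set_pos: "card (msg_set n R) > 0"
  unfolding card_msg_set using msg_size_pos by (intro prod_pos) auto

text \<open>The signal part \<open>s\<close> of the relay input is a parameter, so that the input
  can be split in different ways between \<open>s\<close> and the coordinates \<open>(0, i)\<close>.
  Only the sum of the two matters, by \<open>rx_block_cong\<close>.\<close>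

definition rx_block :: "nat \<Rightarrow> (nat \<Rightarrow> real) \<Rightarrow> (nat \<Rightarrow> (nat \<Rightarrow> real) \<Rightarrow> real) \<Rightarrow> (nat \<Rightarrow> real)
    \<Rightarrow> nat \<Rightarrow> (nat \<times> nat \<Rightarrow> real) \<Rightarrow> nat \<Rightarrow> real" where
  "rx_block n h rel s j \<omega> =
     restrict (\<lambda>i. h j * rel i (restrict (\<lambda>i'. s i' + \<omega> (0, i')) {..<i}) + \<omega> (j, i)) {..<n}"

definition uplink_sum :: "(nat \<Rightarrow> real) \<Rightarrow> (nat \<Rightarrow> (nat \<Rightarrow> nat) \<Rightarrow> nat \<Rightarrow> real)
    \<Rightarrow> (nat \<times> nat \<Rightarrow> nat) \<Rightarrow> nat \<Rightarrow> real" where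
  "uplink_sum h enc m i = h 1 * user_sig enc 1 m i + h 2 * user_sig enc 2 m i + h 3 * user_sig enc 3 m i"

lemma relay_sig_eq:
  "relay_sig h enc rel m \<omega> i = rel i (restrict (\<lambda>i'. uplink_sum h enc m i' + \<omega> (0, i')) {..<i})"
  by (simp add: relay_sig_def relay_rx_def[abs_def] uplink_sum_def)

lemma restrict_user_rx_eq:
  "restrict (user_rx h enc rel j m \<omega>) {..<n} = rx_block n h rel (uplink_sum h enc m) j \<omega>"
  by (simp add: rx_block_def user_rx_def[abs_def] relay_sig_eq)

lemma rx_block_cong:
  assumes "\<And>i. i < n \<Longrightarrow> s i + \<omega> (0, i) = s' i + \<omega>' (0, i)" and "\<And>i. i < n \<Longrightarrow> \<omega> (j, i) = \<omega>' (j, i)"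
  shows "rx_block n h rel s j \<omega> = rx_block n h rel s' j \<omega>'"
proof -
  have "restrict (\<lambda>i'. s i' + \<omega> (0, i')) {..<i} = restrict (\<lambda>i'. s' i' + \<omega>' (0, i')) {..<i}" if "i < n" for i
    using assms(1) that by (intro restrict_ext) auto
  then show ?thesis
    unfolding rx_block_def using assms(2) by (intro restrict_ext) auto
qed

lemma noise_component_measurable:
  "j \<le> 3 \<Longrightarrow> i < n \<Longrightarrow> (\<lambda>\<omega>. \<omega> (j, i)) \<in> borel_measurable (noise_space n)"
  using measurable_component_singleton[of "(j, i)" "{..3} \<times> {..<n}" "\<lambda>_. gauss"]
  by (auto simp: noise_space_eq)

lemma relay_measurable:
  assumes f: "f \<in> borel_measurable (PiM {..<i} (\<lambda>_. borel))" and i: "i < n"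
  shows "(\<lambda>\<omega>. f (restrict (\<lambda>i'. s i' + \<omega> (0, i')) {..<i})) \<in> borel_measurable (noise_space n)"
proof (rule measurable_compose[OF _ f], rule measurable_restrict)
  fix i' assume "i' \<in> {..<i}"
  with i have "i' < n" by simp
  from noise_component_measurable[OF _ this, of 0]
  show "(\<lambda>\<omega>. s i' + \<omega> (0, i')) \<in> borel_measurable (noise_space n)" by simp
qed

lemma rx_block_measurable:
  assumes rel: "\<And>i. i < n \<Longrightarrow> rel i \<in> borel_measurable (PiM {..<i} (\<lambda>_. borel))" and j: "j \<le> 3"
  shows "rx_block n h rel s j \<in> measurable (noise_space n) (PiM {..<n} (\<lambda>_. borel))"
  unfolding rx_block_def
proof (rule measurable_restrict)
  fix i assume "i \<in> {..<n}"
  then have i: "i < n" by simp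
  show "(\<lambda>\<omega>. h j * rel i (restrict (\<lambda>i'. s i' + \<omega> (0, i')) {..<i}) + \<omega> (j, i)) \<in> borel_measurable (noise_space n)"
    using relay_measurable[OF rel[OF i] i, of s] noise_component_measurable[OF j i] by simp
qed

lemma decoder_event_measurable:
  assumes code: "valid_code n R h P enc rel dec" and m: "m \<in> msg_set n R" and j: "j \<in> {1, 2, 3}"
    and Y: "Y \<in> measurable (noise_space n) (PiM {..<n} (\<lambda>_. borel))"
  shows "{\<omega> \<in> space (noise_space n). dec j (\<lambda>k'. m (j, k')) (Y \<omega>) k = (a :: nat)} \<in> sets (noise_space n)"
proof -
  have "(\<lambda>y. dec j (\<lambda>k'. m (j, k')) y k) \<in> measurable (PiM {..<n} (\<lambda>_. borel)) (count_space UNIV)"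
    using code m j unfolding valid_code_def by blast
  from measurable_compose[OF Y this] show ?thesis by measurable
qed

lemma dec_error_measurable:
  assumes code: "valid_code n R h P enc rel dec" and m: "m \<in> msg_set n R"
  shows "{\<omega> \<in> space (noise_space n). dec_error n h enc rel dec m \<omega>} \<in> sets (noise_space n)"
proof -
  have rel: "\<And>i. i < n \<Longrightarrow> rel i \<in> borel_measurable (PiM {..<i} (\<lambda>_. borel))"
    using code unfolding valid_code_def by blast
  let ?ok = "\<lambda>(k, j). {\<omega> \<in> space (noise_space n).
    dec j (\<lambda>k'. m (j, k')) (rx_block n h rel (uplink_sum h enc m) j \<omega>) k = m (k, j)}"
  have ok: "?ok kj \<in> sets (noise_space n)" if "kj \<in> pairs" for kj
  proof (cases kj)
    case (Pair k j)
    then have "j \<in> {1, 2, 3}" "j \<le> 3" using that by (auto simp: pairs_def)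
    then show ?thesis
      unfolding Pair prod.case using rx_block_measurable[OF rel]
      by (intro decoder_event_measurable[OF code m]) auto
  qed
  have "{\<omega> \<in> space (noise_space n). dec_error n h enc rel dec m \<omega>}
      = (\<Union>kj\<in>pairs. space (noise_space n) - ?ok kj)"
    by (auto simp: dec_error_def restrict_user_rx_eq split: prod.splits)
  also have "\<dots> \<in> sets (noise_space n)"
    using ok finite_pairs by (intro sets.finite_UN) auto
  finally show ?thesis .
qed

text \<open>Restriction to \<open>D\<close> is injective on \<open>W'\<close>, and each assignment
  on \<open>D\<close> extends to a full message in as many ways as the product counts. With
  \<open>W'\<close> the messages decoded correctly from one output, this gives \<open>card_G\<close>
  in \<open>converse\<close>.\<close>

lemma card_agreeing_messages:
  assumes D: "D \<subseteq> pairs"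
    and W': "W' \<subseteq> msg_set n R"
    and inj: "\<And>w w'. w \<in> W' \<Longrightarrow> w' \<in> W' \<Longrightarrow> (\<forall>d\<in>D. w d = w' d) \<Longrightarrow> w = w'"
  shows "real (card W') * (\<Prod>jk\<in>pairs - D. real (msg_size n (R jk))) \<le> real (card (msg_set n R))"
proof -
  have fD: "finite D" using D finite_pairs finite_subset by blast
  have "card W' \<le> card (PiE D (\<lambda>jk. {..<msg_size n (R jk)}))"
  proof (rule card_inj_on_le[where f="\<lambda>w. restrict w D"])
    show "inj_on (\<lambda>w. restrict w D) W'"
    proof (rule inj_onI)
      fix w w' assume "w \<in> W'" "w' \<in> W'" and e: "restrict w D = restrict w' D"
      moreover have "\<forall>d\<in>D. w d = w' d" using e by (metis restrict_apply')
      ultimately show "w = w'" using inj by blast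
    qed
    show "(\<lambda>w. restrict w D) ` W' \<subseteq> PiE D (\<lambda>jk. {..<msg_size n (R jk)})"
      using W' D by (fastforce simp: msg_set_def PiE_iff)
    show "finite (PiE D (\<lambda>jk. {..<msg_size n (R jk)}))" using fD by (intro finite_PiE) auto
  qed
  also have "\<dots> = (\<Prod>jk\<in>D. msg_size n (R jk))" using fD by (simp add: card_PiE)
  finally have "real (card W') \<le> (\<Prod>jk\<in>D. real (msg_size n (R jk)))"
    using of_nat_mono by fastforce
  then have "real (card W') * (\<Prod>jk\<in>pairs - D. real (msg_size n (R jk)))
      \<le> (\<Prod>jk\<in>D. real (msg_size n (R jk))) * (\<Prod>jk\<in>pairs - D. real (msg_size n (R jk)))"
    by (intro mult_right_mono prod_nonneg) auto
  also have "\<dots> = real (card (msg_set n R))"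
    using prod.subset_diff[OF D finite_pairs, of "\<lambda>jk. real (msg_size n (R jk))"] by (simp add: card_msg_set mult.commute)
  finally show ?thesis .
qed

lemma error_prob_le_1: "error_prob n R h enc rel dec \<le> 1"
proof -
  interpret prob_space "noise_space n" unfolding noise_space_eq by (rule prob_space_gauss_PiM)
  have "(\<Sum>m\<in>msg_set n R. prob {\<omega> \<in> space (noise_space n). dec_error n h enc rel dec m \<omega>}) \<le> (\<Sum>m\<in>msg_set n R. 1)"
    by (intro sum_mono prob_le_1)
  then show ?thesis
    using card_msg_set_pos[of n R] by (simp add: error_prob_def divide_le_eq)
qed

text \<open>The set D collects the messages handed to the decoders as side information. A success
event expressed through the received block and D alone determines the remaining messages.\<close>
lemma code_converse:
  assumes code: "valid_code n R h P enc rel dec"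
    and block: "gaussian_block ({..3} \<times> {..<n}) B n Q"
    and x: "\<And>w. w \<in> msg_set n R \<Longrightarrow> gaussian_block.block_input ({..3} \<times> {..<n}) B n (x w)"
    and power: "(\<Sum>i<n. \<Sum>w\<in>msg_set n R. \<integral>\<^sup>+\<omega>. ennreal ((x w \<omega> i)\<^sup>2) \<partial>noise_space n)
      \<le> ennreal (real n * real (card (msg_set n R)) * Q)"
    and G: "\<And>w. w \<in> msg_set n R \<Longrightarrow> G w \<in> sets (noise_space n)"
    and D: "D \<subseteq> pairs"
    and inj: "\<And>\<omega> w w'. w \<in> msg_set n R \<Longrightarrow> w' \<in> msg_set n R \<Longrightarrow> \<omega> \<in> G w \<Longrightarrow> \<omega> \<in> G w'
      \<Longrightarrow> (\<forall>d\<in>D. w d = w' d) \<Longrightarrow> w = w'"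
    and success: "\<And>w \<omega>. w \<in> msg_set n R \<Longrightarrow> \<omega> \<in> space (noise_space n) \<Longrightarrow> \<not> dec_error n h enc rel dec w \<omega>
      \<Longrightarrow> gaussian_block.received ({..3} \<times> {..<n}) B n v (x w) \<omega> \<in> G w"
  shows "(1 - error_prob n R h enc rel dec) * (real n * (\<Sum>jk\<in>pairs - D. R jk) * ln 2)
      \<le> real n * (ln (1 + (\<Sum>b\<in>B. (v b)\<^sup>2) * Q) / 2) + ln 2"
proof -
  interpret gaussian_block "{..3} \<times> {..<n}" B n v Q by (rule block)
  interpret prob_space "noise_space n" unfolding noise_space_eq by (rule prob_space_gauss_PiM)
  let ?W = "msg_set n R" and ?M = "\<Prod>jk\<in>pairs - D. real (msg_size n (R jk))"
  let ?err = "\<lambda>w. {\<omega> \<in> space (noise_space n). dec_error n h enc rel dec w \<omega>}"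
  let ?A = "\<lambda>w. {\<omega> \<in> space (noise_space n). received (x w) \<omega> \<in> G w}"
  have M1: "?M \<ge> 1"
    using msg_size_pos by (intro prod_ge_1) (simp add: Suc_le_eq)
  have W: "real (card ?W) > 0" using card_msg_set_pos by simp
  have main: "(\<Sum>w\<in>?W. prob (?A w)) * ln ?M \<le> real (card ?W) * (real n / 2 * ln (1 + snr) + ln 2)"
    unfolding noise_space_eq
  proof (rule converse[OF finite_msg_set M1 x])
    show "(\<Sum>i<n. \<Sum>w\<in>?W. \<integral>\<^sup>+\<omega>. ennreal ((x w \<omega> i)\<^sup>2) \<partial>noise) \<le> ennreal (real n * real (card ?W) * Q)"
      using power unfolding noise_space_eq .
    show "G w \<in> sets noise" if "w \<in> ?W" for w
      using G[OF that] unfolding noise_space_eq .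
    show "real (card {w \<in> ?W. \<omega> \<in> G w}) * ?M \<le> real (card ?W)" for \<omega>
      by (rule card_agreeing_messages[OF D]) (auto intro: inj)
  qed
  have A: "1 - prob (?err w) \<le> prob (?A w)" if w: "w \<in> ?W" for w
  proof -
    have "1 - prob (?err w) = prob (space (noise_space n) - ?err w)"
      using prob_compl[OF dec_error_measurable[OF code w]] by simp
    also have "\<dots> \<le> prob (?A w)"
    proof (rule finite_measure_mono)
      show "space (noise_space n) - ?err w \<subseteq> ?A w" using success[OF w] by auto
      show "?A w \<in> sets (noise_space n)"
        using measurable_sets[OF received_measurable[OF x[OF w]], of "G w"] G[OF w]
        by (simp add: noise_space_eq vimage_def Int_def conj_commute)
    qed
    finally show ?thesis .
  qed
  have "real (card ?W) * (1 - error_prob n R h enc rel dec) = (\<Sum>w\<in>?W. 1 - prob (?err w))"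
    using W by (simp add: error_prob_def sum_subtractf right_diff_distrib)
  also have "\<dots> \<le> (\<Sum>w\<in>?W. prob (?A w))" using A by (rule sum_mono)
  finally have "real (card ?W) * (1 - error_prob n R h enc rel dec) * ln ?M \<le> (\<Sum>w\<in>?W. prob (?A w)) * ln ?M"
    using M1 by (intro mult_right_mono) auto
  with main have "real (card ?W) * ((1 - error_prob n R h enc rel dec) * ln ?M)
      \<le> real (card ?W) * (real n / 2 * ln (1 + snr) + ln 2)" by (simp add: mult.assoc)
  then have 1: "(1 - error_prob n R h enc rel dec) * ln ?M \<le> real n / 2 * ln (1 + snr) + ln 2"
    using W by (simp only: mult_le_cancel_left_pos)
  \<comment> \<open>Rounding up in \<open>msg_size\<close> only enlarges the alphabets, so
    \<open>ln ?M\<close> dominates the rates.\<close>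
  have "real n * (\<Sum>jk\<in>pairs - D. R jk) * ln 2 = (\<Sum>jk\<in>pairs - D. ln (2 powr (real n * R jk)))"
    by (simp add: ln_powr sum_distrib_left sum_distrib_right)
  also have "\<dots> \<le> (\<Sum>jk\<in>pairs - D. ln (real (msg_size n (R jk))))"
    using msg_size_ge msg_size_pos by (intro sum_mono iffD2[OF ln_le_cancel_iff]) auto
  also have "\<dots> = ln ?M"
    using finite_pairs msg_size_pos by (subst ln_prod) auto
  finally have "(1 - error_prob n R h enc rel dec) * (real n * (\<Sum>jk\<in>pairs - D. R jk) * ln 2)
      \<le> (1 - error_prob n R h enc rel dec) * ln ?M"
    using error_prob_le_1[of n R h enc rel dec] by (intro mult_left_mono) auto
  with 1 show ?thesis by (simp add: snr_def gain_def)
qed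

section \<open>Downlink bound\<close>

lemma msg_set_row_eq:
  assumes "w \<in> msg_set n R" "w' \<in> msg_set n R"
    and "\<And>k. (j, k) \<in> pairs \<Longrightarrow> w (j, k) = w' (j, k)"
  shows "(\<lambda>k. w (j, k)) = (\<lambda>k. w' (j, k))"
proof
  fix k
  show "w (j, k) = w' (j, k)"
    \<comment> \<open>Decoders take the whole row as a function; at indices outside
      \<open>pairs\<close> both rows are \<open>undefined\<close> by extensionality.\<close>
    using assms by (cases "(j, k) \<in> pairs") (auto simp: msg_set_def PiE_def extensional_def)
qed

lemma msg_set_eqI:
  assumes "w \<in> msg_set n R" "w' \<in> msg_set n R" and "\<And>p. p \<in> pairs \<Longrightarrow> w p = w' p"
  shows "w = w'"
  using assms unfolding msg_set_def by (rule PiE_ext)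

text \<open>The block consists of the outputs of users 2 and 3, and its input is the relay signal
  with power \<open>P\<close>. The relay noise stays outside the block, so the signal may depend on
  it, and the squared gains add up to the required factor.\<close>

lemma downlink_bound:
  assumes P: "P > 0" and code: "valid_code n R h P enc rel dec"
  shows "(1 - error_prob n R h enc rel dec) * (real n * (R (1,2) + R (1,3) + R (3,2)) * ln 2)
      \<le> real n * (ln (1 + ((h 2)\<^sup>2 + (h 3)\<^sup>2) * P) / 2) + ln 2"
proof -
  let ?I = "{..3::nat} \<times> {..<n}" and ?B = "{2, 3::nat}" and ?D = "{(2,1), (2,3), (3,1)} :: (nat \<times> nat) set"
  interpret gaussian_block ?I ?B n h P by unfold_locales (use P in auto)
  let ?y = "\<lambda>\<omega> j. restrict (\<lambda>i. \<omega> (j, i)) {..<n} :: nat \<Rightarrow> real"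
  \<comment> \<open>Coordinate \<open>(j, i)\<close> of \<open>\<omega>\<close> stands here for an
    output of user \<open>j\<close>, no longer for its noise.\<close>
  define G where "G w = {\<omega> \<in> space (noise_space n). dec 2 (\<lambda>k. w (2, k)) (?y \<omega> 2) 1 = w (1, 2)}
    \<inter> {\<omega> \<in> space (noise_space n). dec 2 (\<lambda>k. w (2, k)) (?y \<omega> 2) 3 = w (3, 2)}
    \<inter> {\<omega> \<in> space (noise_space n). dec 3 (\<lambda>k. w (3, k)) (?y \<omega> 3) 1 = w (1, 3)}" for w :: "nat \<times> nat \<Rightarrow> nat"
  let ?x = "\<lambda>w \<omega> i. relay_sig h enc rel w \<omega> i"
  have rel: "\<And>i. i < n \<Longrightarrow> rel i \<in> borel_measurable (PiM {..<i} (\<lambda>_. borel))"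
    using code unfolding valid_code_def by blast
  have x: "block_input (?x w)" for w
    unfolding block_input_def
  proof (intro conjI allI impI)
    fix i assume i: "i < n"
    show "(\<lambda>\<omega>. ?x w \<omega> i) \<in> borel_measurable (PiM ?I (\<lambda>_. gauss))"
      unfolding relay_sig_eq noise_space_eq[symmetric] by (rule relay_measurable[OF rel[OF i] i])
    \<comment> \<open>The relay reads only coordinates \<open>(0, i')\<close>, which lie outside the
      block.\<close>
    fix \<omega> \<omega>' :: "nat \<times> nat \<Rightarrow> real" assume "\<forall>k\<in>?I - ?B \<times> {..<n}. \<omega> k = \<omega>' k"
    with i have "restrict (\<lambda>i'. uplink_sum h enc w i' + \<omega> (0, i')) {..<i} = restrict (\<lambda>i'. uplink_sum h enc w i' + \<omega>' (0, i')) {..<i}"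
      by (intro restrict_ext) auto
    then show "?x w \<omega> i = ?x w \<omega>' i" unfolding relay_sig_eq by simp
  qed
  have y: "(\<lambda>\<omega>. ?y \<omega> j) \<in> measurable (noise_space n) (PiM {..<n} (\<lambda>_. borel))" if "j \<le> 3" for j
    using that noise_component_measurable by (intro measurable_restrict) auto
  have G: "G w \<in> sets (noise_space n)" if "w \<in> msg_set n R" for w
    unfolding G_def by (intro sets.Int decoder_event_measurable[OF code that] y) auto
  have "(1 - error_prob n R h enc rel dec) * (real n * (\<Sum>jk\<in>pairs - ?D. R jk) * ln 2)
      \<le> real n * (ln (1 + (\<Sum>b\<in>?B. (h b)\<^sup>2) * P) / 2) + ln 2"
  proof (rule code_converse[where v=h, OF code gaussian_block_axioms x _ G])
    show "(\<Sum>i<n. \<Sum>w\<in>msg_set n R. \<integral>\<^sup>+\<omega>. ennreal ((?x w \<omega> i)\<^sup>2) \<partial>noise_space n)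
      \<le> ennreal (real n * real (card (msg_set n R)) * P)"
      using code unfolding valid_code_def by blast
    show "?D \<subseteq> pairs" by (auto simp: pairs_eq)
  next
    fix \<omega> w w' assume w: "w \<in> msg_set n R" "w' \<in> msg_set n R" and g: "\<omega> \<in> G w" "\<omega> \<in> G w'"
      and d: "\<forall>d\<in>?D. w d = w' d"
    \<comment> \<open>The row of user 2 lies in \<open>?D\<close>, so its decoder returns the same
      estimates for both messages. The recovered \<open>w (3, 2)\<close> completes the row of user
      3, whose decoder then settles \<open>w (1, 3)\<close>.\<close>
    have 2: "(\<lambda>k. w (2, k)) = (\<lambda>k. w' (2, k))"
      by (rule msg_set_row_eq[OF w]) (use d in \<open>auto simp: pairs_eq\<close>)
    have e: "w (1, 2) = w' (1, 2)" "w (3, 2) = w' (3, 2)"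
      using g 2 by (auto simp: G_def)
    have 3: "(\<lambda>k. w (3, k)) = (\<lambda>k. w' (3, k))"
      by (rule msg_set_row_eq[OF w]) (use d e in \<open>auto simp: pairs_eq\<close>)
    have "w (1, 3) = w' (1, 3)"
      using g 3 by (auto simp: G_def)
    with d e show "w = w'" by (intro msg_set_eqI[OF w]) (auto simp: pairs_eq)
  next
    fix w \<omega> assume w: "w \<in> msg_set n R" and \<omega>: "\<omega> \<in> space (noise_space n)"
      and ok: "\<not> dec_error n h enc rel dec w \<omega>"
    have rec: "?y (received (?x w) \<omega>) j = restrict (user_rx h enc rel j w \<omega>) {..<n}" if "j \<in> ?B" for j
      using that by (intro restrict_ext) (auto simp: received_def user_rx_def)
    have sp: "received (?x w) \<omega> \<in> space (noise_space n)"
      using measurable_space[OF received_measurable[OF x]] \<omega> by (simp add: noise_space_eq)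
    from ok show "received (?x w) \<omega> \<in> G w"
      using sp by (auto simp: G_def rec dec_error_def pairs_eq)
  qed
  moreover have "pairs - ?D = {(1,2), (1,3), (3,2)}" by (auto simp: pairs_eq)
  ultimately show ?thesis by (simp add: add.assoc)
qed

section \<open>Uplink bound\<close>

lemma sum_PiE_product_of_independent:
  fixes f g :: "('k \<Rightarrow> 'a) \<Rightarrow> real"
  assumes f: "\<And>w w'. w \<in> PiE A S \<Longrightarrow> w' \<in> PiE A S \<Longrightarrow> (\<forall>k\<in>A'. w k = w' k) \<Longrightarrow> f w = f w'"
    and g: "\<And>w w'. w \<in> PiE A S \<Longrightarrow> w' \<in> PiE A S \<Longrightarrow> (\<forall>k\<in>A - A'. w k = w' k) \<Longrightarrow> g w = g w'"
    and A': "A' \<subseteq> A"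
  shows "real (card (PiE A S)) * (\<Sum>w\<in>PiE A S. f w * g w) = (\<Sum>w\<in>PiE A S. f w) * (\<Sum>w\<in>PiE A S. g w)"
proof -
  let ?W = "PiE A S"
  \<comment> \<open>Exchanging the coordinates in \<open>A'\<close> between the members of a pair is
    an involution on pairs, and it turns \<open>f w' * g w\<close> into \<open>f w * g w\<close>.
    This is independence of disjoint coordinates under the uniform law.\<close>
  define mix where "mix w w' = (\<lambda>k\<in>A. if k \<in> A' then w' k else w k)" for w w' :: "'k \<Rightarrow> 'a"
  have mix: "mix w w' \<in> ?W" if "w \<in> ?W" "w' \<in> ?W" for w w'
    using that by (auto simp: mix_def PiE_iff)
  have mm: "mix (mix w w') (mix w' w) = w" if "w \<in> ?W" "w' \<in> ?W" for w w'
    using that by (auto simp: mix_def fun_eq_iff PiE_iff extensional_def)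
  have "(\<Sum>w\<in>?W. f w) * (\<Sum>w\<in>?W. g w) = (\<Sum>p\<in>?W \<times> ?W. f (snd p) * g (fst p))"
    by (subst sum_product, subst sum.swap) (simp add: sum.cartesian_product split_beta)
  also have "\<dots> = (\<Sum>p\<in>?W \<times> ?W. f (fst p) * g (fst p))"
  proof (rule sum.reindex_bij_witness[where i="\<lambda>(w, w'). (mix w w', mix w' w)" and j="\<lambda>(w, w'). (mix w w', mix w' w)"])
    fix p assume "p \<in> ?W \<times> ?W"
    then obtain w w' where p: "p = (w, w')" "w \<in> ?W" "w' \<in> ?W" by auto
    have "f (mix w w') = f w'" "g (mix w w') = g w"
      using p mix A' by (auto intro!: f g simp: mix_def)
    then show "f (fst (case p of (w, w') \<Rightarrow> (mix w w', mix w' w))) * g (fst (case p of (w, w') \<Rightarrow> (mix w w', mix w' w)))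
      = f (snd p) * g (fst p)" by (simp add: p)
  qed (simp_all add: split_beta mem_Times_iff prod_eq_iff mix mm)
  also have "\<dots> = (\<Sum>w\<in>?W. \<Sum>w'\<in>?W. f w * g w)"
    unfolding sum.cartesian_product by (simp only: case_prod_unfold)
  also have "\<dots> = real (card ?W) * (\<Sum>w\<in>?W. f w * g w)" by (simp add: sum_distrib_left)
  finally show ?thesis by simp
qed

text \<open>Restricted encoding enters here: the two signals are functions of disjoint sets of
  independent messages.\<close>

lemma uncorrelated_user_signals:
  "real (card (msg_set n R)) * (\<Sum>w\<in>msg_set n R. user_sig enc 2 w i * user_sig enc 3 w i)
    = (\<Sum>w\<in>msg_set n R. user_sig enc 2 w i) * (\<Sum>w\<in>msg_set n R. user_sig enc 3 w i)"
  unfolding msg_set_def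
proof (rule sum_PiE_product_of_independent[where A'="{(2,1), (2,3)}"])
  fix w w' assume w: "w \<in> PiE pairs (\<lambda>jk. {..<msg_size n (R jk)})" "w' \<in> PiE pairs (\<lambda>jk. {..<msg_size n (R jk)})"
  note w' = w[folded msg_set_def]
  show "user_sig enc 2 w i = user_sig enc 2 w' i" if "\<forall>k\<in>{(2,1), (2,3)}. w k = w' k"
    using msg_set_row_eq[OF w', of 2] that by (auto simp: user_sig_def pairs_eq)
  show "user_sig enc 3 w i = user_sig enc 3 w' i" if "\<forall>k\<in>pairs - {(2,1), (2,3)}. w k = w' k"
    using msg_set_row_eq[OF w', of 3] that by (auto simp: user_sig_def pairs_eq)
qed (auto simp: pairs_eq)

text \<open>The block is the relay's observation alone, with unit gain and the received power bound
  \<open>?Q\<close> as its power. The noise of the users stays outside the block, so the decoders'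
  inputs can be recomputed from the block, that noise and the side information.\<close>

lemma uplink_bound:
  assumes P: "P > 0" and code: "valid_code n R h P enc rel dec"
  shows "(1 - error_prob n R h enc rel dec) * (real n * (R (2,1) + R (2,3) + R (3,1)) * ln 2)
      \<le> real n * (ln (1 + ((h 2)\<^sup>2 + (h 3)\<^sup>2) * P) / 2) + ln 2"
proof -
  let ?I = "{..3::nat} \<times> {..<n}" and ?D = "{(1,2), (1,3), (3,2)} :: (nat \<times> nat) set"
  let ?W = "msg_set n R" and ?Q = "((h 2)\<^sup>2 + (h 3)\<^sup>2) * P"
  interpret gaussian_block ?I "{0}" n "\<lambda>_. 1" ?Q by unfold_locales (use P in auto)
  interpret prob_space "noise_space n" unfolding noise_space_eq by (rule prob_space_gauss_PiM)
  let ?X = "user_sig enc"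
  \<comment> \<open>\<open>c i\<close> is the mean of user 2's symbol over all messages. Centring
    one of the two signals already makes their average product vanish.\<close>
  define c where "c i = (\<Sum>w\<in>?W. ?X 2 w i) / real (card ?W)" for i
  define d where "d w i = h 2 * (?X 2 w i - c i) + h 3 * ?X 3 w i" for w i
  \<comment> \<open>This part of the relay input depends on \<open>w\<close> only through the
    messages of user 1, all of which are in \<open>?D\<close>.\<close>
  define \<mu> where "\<mu> w i = h 1 * ?X 1 w i + h 2 * c i" for w i
  \<comment> \<open>Coordinate \<open>(0, i)\<close> of \<open>\<omega>\<close> now stands for the
    relay input minus \<open>\<mu> w i\<close>; adding \<open>\<mu> w\<close> back yields what the
    relay actually sees.\<close>
  let ?y = "\<lambda>w \<omega> j. rx_block n h rel (\<mu> w) j \<omega>"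
  define G where "G w = {\<omega> \<in> space (noise_space n). dec 1 (\<lambda>k. w (1, k)) (?y w \<omega> 1) 2 = w (2, 1)}
    \<inter> {\<omega> \<in> space (noise_space n). dec 1 (\<lambda>k. w (1, k)) (?y w \<omega> 1) 3 = w (3, 1)}
    \<inter> {\<omega> \<in> space (noise_space n). dec 3 (\<lambda>k. w (3, k)) (?y w \<omega> 3) 2 = w (2, 3)}" for w :: "nat \<times> nat \<Rightarrow> nat"
  have rel: "\<And>i. i < n \<Longrightarrow> rel i \<in> borel_measurable (PiM {..<i} (\<lambda>_. borel))"
    using code unfolding valid_code_def by blast
  have W: "real (card ?W) > 0" using card_msg_set_pos by simp
  have x: "block_input (\<lambda>_. d w)" for w
    by (simp add: block_input_def)
  have G: "G w \<in> sets (noise_space n)" if "w \<in> ?W" for w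
    unfolding G_def using rx_block_measurable[OF rel] that
    by (intro sets.Int decoder_event_measurable[OF code]) auto
  have dsq: "(\<Sum>w\<in>?W. (d w i)\<^sup>2) \<le> (h 2)\<^sup>2 * (\<Sum>w\<in>?W. (?X 2 w i)\<^sup>2) + (h 3)\<^sup>2 * (\<Sum>w\<in>?W. (?X 3 w i)\<^sup>2)" for i
  proof -
    let ?N = "real (card ?W)"
    have c: "(\<Sum>w\<in>?W. ?X 2 w i) = ?N * c i" using W by (simp add: c_def)
    have cr: "(\<Sum>w\<in>?W. ?X 2 w i * ?X 3 w i) = c i * (\<Sum>w\<in>?W. ?X 3 w i)"
      using uncorrelated_user_signals[of n R enc i] W by (simp add: c_def field_simps)
    have "(d w i)\<^sup>2 = (h 2)\<^sup>2 * (?X 2 w i)\<^sup>2 + (h 3)\<^sup>2 * (?X 3 w i)\<^sup>2 + 2 * h 2 * h 3 * (?X 2 w i * ?X 3 w i)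
       - 2 * h 2 * h 3 * c i * ?X 3 w i - 2 * (h 2)\<^sup>2 * c i * ?X 2 w i + (h 2)\<^sup>2 * (c i)\<^sup>2" for w
      by (simp add: d_def power2_eq_square algebra_simps)
    then have "(\<Sum>w\<in>?W. (d w i)\<^sup>2) = (h 2)\<^sup>2 * (\<Sum>w\<in>?W. (?X 2 w i)\<^sup>2) + (h 3)\<^sup>2 * (\<Sum>w\<in>?W. (?X 3 w i)\<^sup>2)
       + 2 * h 2 * h 3 * (\<Sum>w\<in>?W. ?X 2 w i * ?X 3 w i) - 2 * h 2 * h 3 * c i * (\<Sum>w\<in>?W. ?X 3 w i)
       - 2 * (h 2)\<^sup>2 * c i * (\<Sum>w\<in>?W. ?X 2 w i) + ?N * ((h 2)\<^sup>2 * (c i)\<^sup>2)"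
      by (simp add: sum.distrib sum_subtractf sum_distrib_left)
    \<comment> \<open>The cross moment cancels against the term from centring, and what centring
      leaves is a nonpositive correction.\<close>
    also have "\<dots> = (h 2)\<^sup>2 * (\<Sum>w\<in>?W. (?X 2 w i)\<^sup>2) + (h 3)\<^sup>2 * (\<Sum>w\<in>?W. (?X 3 w i)\<^sup>2) - ?N * ((h 2)\<^sup>2 * (c i)\<^sup>2)"
      unfolding c cr by (simp add: power2_eq_square algebra_simps)
    finally show ?thesis by simp
  qed
  have pow: "(\<Sum>i<n. \<Sum>w\<in>?W. (?X j w i)\<^sup>2) \<le> real n * real (card ?W) * P" if "j \<in> {1, 2, 3}" for j
    using code that unfolding valid_code_def by blast
  have "(1 - error_prob n R h enc rel dec) * (real n * (\<Sum>jk\<in>pairs - ?D. R jk) * ln 2)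
      \<le> real n * (ln (1 + (\<Sum>b\<in>{0::nat}. 1\<^sup>2) * ?Q) / 2) + ln 2"
  proof (rule code_converse[where v="\<lambda>_. 1", OF code gaussian_block_axioms x _ G])
    have "(\<Sum>i<n. \<Sum>w\<in>?W. (d w i)\<^sup>2)
        \<le> (\<Sum>i<n. (h 2)\<^sup>2 * (\<Sum>w\<in>?W. (?X 2 w i)\<^sup>2) + (h 3)\<^sup>2 * (\<Sum>w\<in>?W. (?X 3 w i)\<^sup>2))"
      by (intro sum_mono dsq)
    also have "\<dots> = (h 2)\<^sup>2 * (\<Sum>i<n. \<Sum>w\<in>?W. (?X 2 w i)\<^sup>2) + (h 3)\<^sup>2 * (\<Sum>i<n. \<Sum>w\<in>?W. (?X 3 w i)\<^sup>2)"
      by (simp add: sum.distrib sum_distrib_left)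
    also have "\<dots> \<le> (h 2)\<^sup>2 * (real n * real (card ?W) * P) + (h 3)\<^sup>2 * (real n * real (card ?W) * P)"
      by (intro add_mono mult_left_mono pow) auto
    also have "\<dots> = real n * real (card ?W) * ?Q" by (simp add: algebra_simps)
    finally have "ennreal (\<Sum>i<n. \<Sum>w\<in>?W. (d w i)\<^sup>2) \<le> ennreal (real n * real (card ?W) * ?Q)"
      by (rule ennreal_leI)
    then show "(\<Sum>i<n. \<Sum>w\<in>?W. \<integral>\<^sup>+\<omega>. ennreal ((d w i)\<^sup>2) \<partial>noise_space n) \<le> ennreal (real n * real (card ?W) * ?Q)"
      by (simp add: emeasure_space_1 sum_nonneg)
    show "?D \<subseteq> pairs" by (auto simp: pairs_eq)
  next
    fix \<omega> w w' assume w: "w \<in> ?W" "w' \<in> ?W" and g: "\<omega> \<in> G w" "\<omega> \<in> G w'"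
      and D: "\<forall>d\<in>?D. w d = w' d"
    \<comment> \<open>User 1's row is side information, so both \<open>\<mu>\<close> and its decoder
      agree for the two messages. The recovered \<open>w (3, 1)\<close> completes the row of user
      3.\<close>
    have 1: "(\<lambda>k. w (1, k)) = (\<lambda>k. w' (1, k))"
      by (rule msg_set_row_eq[OF w]) (use D in \<open>auto simp: pairs_eq\<close>)
    have \<mu>: "\<mu> w = \<mu> w'" using 1 by (simp add: \<mu>_def[abs_def] user_sig_def)
    have e: "w (2, 1) = w' (2, 1)" "w (3, 1) = w' (3, 1)"
      using g 1 \<mu> by (auto simp: G_def)
    have 3: "(\<lambda>k. w (3, k)) = (\<lambda>k. w' (3, k))"
      by (rule msg_set_row_eq[OF w]) (use D e in \<open>auto simp: pairs_eq\<close>)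
    have "w (2, 3) = w' (2, 3)"
      using g 3 \<mu> by (auto simp: G_def)
    with D e show "w = w'" by (intro msg_set_eqI[OF w]) (auto simp: pairs_eq)
  next
    fix w \<omega> assume w: "w \<in> ?W" and \<omega>: "\<omega> \<in> space (noise_space n)"
      and ok: "\<not> dec_error n h enc rel dec w \<omega>"
    have rec: "?y w (received (\<lambda>_. d w) \<omega>) j = restrict (user_rx h enc rel j w \<omega>) {..<n}" if "j \<in> {1, 3}" for j
      unfolding restrict_user_rx_eq using that
      by (intro rx_block_cong) (auto simp: received_def uplink_sum_def \<mu>_def d_def algebra_simps)
    have sp: "received (\<lambda>_. d w) \<omega> \<in> space (noise_space n)"
      using measurable_space[OF received_measurable[OF x]] \<omega> by (simp add: noise_space_eq)
    from ok show "received (\<lambda>_. d w) \<omega> \<in> G w"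
      using sp by (auto simp: G_def rec dec_error_def pairs_eq)
  qed
  moreover have "pairs - ?D = {(2,1), (2,3), (3,1)}" by (auto simp: pairs_eq)
  ultimately show ?thesis by (simp add: add.assoc)
qed

section \<open>Limit in the block length\<close>

lemma rate_limit:
  fixes \<epsilon> :: "nat \<Rightarrow> real" and r K :: real
  assumes "\<epsilon> \<longlonglongrightarrow> 0" and bound: "\<And>n. n > 0 \<Longrightarrow> (1 - \<epsilon> n) * (real n * r * ln 2) \<le> real n * K + ln 2"
  shows "r * ln 2 \<le> K"
proof (rule LIMSEQ_le)
  show "(\<lambda>n. (1 - \<epsilon> n) * (r * ln 2)) \<longlonglongrightarrow> r * ln 2"
    using assms(1) by (auto intro!: tendsto_eq_intros)
  show "(\<lambda>n. K + ln 2 / real n) \<longlonglongrightarrow> K"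
    using tendsto_add[OF tendsto_const lim_const_over_n, of K "ln 2"] by simp
  show "\<exists>N. \<forall>n\<ge>N. (1 - \<epsilon> n) * (r * ln 2) \<le> K + ln 2 / real n"
  \<comment> \<open>The finite-length bound holds for \<open>n > 0\<close> only, where it may be
    divided by \<open>n\<close>.\<close>
  proof (intro exI[of _ 1] allI impI)
    fix n :: nat assume "1 \<le> n"
    then have n: "real n > 0" by simp
    have "real n * ((1 - \<epsilon> n) * (r * ln 2)) \<le> real n * (K + ln 2 / real n)"
      using bound[of n] n by (simp add: algebra_simps)
    then show "(1 - \<epsilon> n) * (r * ln 2) \<le> K + ln 2 / real n"
      using n by (simp only: mult_le_cancel_left_pos)
  qed
qed

theorem theorem6:
  fixes h :: "nat \<Rightarrow> real" and P :: real
  assumes "P > 0" and "(h 1)\<^sup>2 \<ge> (h 2)\<^sup>2" and "(h 2)\<^sup>2 \<ge> (h 3)\<^sup>2"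
  shows "sum_capacity h P \<le> ereal (2 * C (((h 2)\<^sup>2 + (h 3)\<^sup>2) * P))"
  unfolding sum_capacity_def
proof (rule SUP_least)
  fix R assume "R \<in> {R. achievable h P R}"
  then obtain enc rel dec where
    code: "\<And>n. n > 0 \<Longrightarrow> valid_code n R h P (enc n) (rel n) (dec n)"
    and err: "(\<lambda>n. error_prob n R h (enc n) (rel n) (dec n)) \<longlonglongrightarrow> 0"
    unfolding achievable_def by auto
  let ?K = "ln (1 + ((h 2)\<^sup>2 + (h 3)\<^sup>2) * P) / 2"
  have "(R (1,2) + R (1,3) + R (3,2)) * ln 2 \<le> ?K"
    using rate_limit[OF err downlink_bound[OF assms(1) code]] .
  moreover have "(R (2,1) + R (2,3) + R (3,1)) * ln 2 \<le> ?K"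
    using rate_limit[OF err uplink_bound[OF assms(1) code]] .
  \<comment> \<open>The two triples partition \<open>pairs\<close>, which produces the factor
    2.\<close>
  ultimately have "(\<Sum>jk\<in>pairs. R jk) * ln 2 \<le> 2 * ?K"
    by (simp add: pairs_eq algebra_simps)
  then have "(\<Sum>jk\<in>pairs. R jk) \<le> 2 * ?K / ln 2"
    by (simp add: pos_le_divide_eq)
  also have "\<dots> = 2 * C (((h 2)\<^sup>2 + (h 3)\<^sup>2) * P)"
    by (simp add: C_def log_def)
  finally show "ereal (\<Sum>jk\<in>pairs. R jk) \<le> ereal (2 * C (((h 2)\<^sup>2 + (h 3)\<^sup>2) * P))" by simp
qed

end
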